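(* Let $\{X(t):t\ge0\}$ be a continuous-time Markov chain with finite state space $\mathcal{S}$, irreducible generator $Q$ and stationary distribution $(\pi_j)_{j\in\mathcal{S}}$. For $j\in\mathcal{S}$ let $\theta_j=\inf\{t\ge0:X(t)=j\}$ and let $M_j(t)=\int_0^t\mathbb{1}\{X(u)=j\}\,\mathrm{d}u$. Then for every $i\in\mathcal{S}$, $$\sum_{j\in\mathcal{S}}\pi_j\,\mathrm{E}_i[\theta_j]=\lim_{t\to\infty}\Big(\sum_{j\in\mathcal{S}}\mathrm{E}_j[M_j(t)]-t\Big),$$ and in particular the left-hand side is independent of $i$.
   Context: $\mathrm{E}_i[\cdot]$ denotes conditional expectation given $X(0)=i$. The stationary distribution is the unique probability vector $\boldsymbol\pi$ with $\boldsymbol\pi^{\mathsf T}Q=0$. *)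

theory Defs
  imports "HOL-Probability.Probability"
begin

text \<open>The state space is a finite type; matrices and vectors indexed by it are
  \<^typ>\<open>real^'s^'s\<close> and \<^typ>\<open>real^'s\<close>.\<close>

definition generator_matrix :: "real^'s::finite^'s \<Rightarrow> bool" where
  "generator_matrix Q \<longleftrightarrow>
     (\<forall>i j. i \<noteq> j \<longrightarrow> 0 \<le> Q $ i $ j) \<and> (\<forall>i. (\<Sum>j\<in>UNIV. Q $ i $ j) = 0)"

definition irreducible_generator :: "real^'s::finite^'s \<Rightarrow> bool" where
  "irreducible_generator Q \<longleftrightarrow>
     generator_matrix Q \<and> (\<forall>i j. (i, j) \<in> {(k, l). k \<noteq> l \<and> 0 < Q $ k $ l}\<^sup>*)"

definition stationary_distribution :: "real^'s::finite^'s \<Rightarrow> real^'s \<Rightarrow> bool" where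
  "stationary_distribution Q p \<longleftrightarrow>
     (\<forall>j. 0 \<le> p $ j) \<and> (\<Sum>j\<in>UNIV. p $ j) = 1 \<and> p v* Q = 0"

text \<open>A stochastic semigroup \<open>P\<close> on \<open>[0, \<infinity>)\<close> whose right derivative at \<open>0\<close>
  is \<open>Q\<close>. The values of \<open>P\<close> at negative times are irrelevant.\<close>

definition transition_semigroup ::
    "(real \<Rightarrow> real^'s::finite^'s) \<Rightarrow> real^'s^'s \<Rightarrow> bool" where
  "transition_semigroup P Q \<longleftrightarrow>
     (\<forall>t\<ge>0. (\<forall>i j. 0 \<le> P t $ i $ j) \<and> (\<forall>i. (\<Sum>j\<in>UNIV. P t $ i $ j) = 1)) \<and>
     P 0 = mat 1 \<and>
     (\<forall>s\<ge>0. \<forall>t\<ge>0. P (s + t) = P s ** P t) \<and>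
     (P has_vector_derivative Q) (at_right 0)"

text \<open>The chain is homogeneous with generator \<open>Q\<close>, has an arbitrary initial
  distribution, and its paths are right-continuous for the discrete topology on the states.
  In the Markov property, \<open>\<tau> 0 < \<dots> < \<tau> (Suc n)\<close> are the observation times.
  Only the variables \<open>X t\<close> with \<open>t \<ge> 0\<close> matter.\<close>

definition continuous_time_markov_chain ::
    "'w measure \<Rightarrow> (real \<Rightarrow> 'w \<Rightarrow> 's::finite) \<Rightarrow> real^'s^'s \<Rightarrow> bool" where
  "continuous_time_markov_chain M X Q \<longleftrightarrow>
     prob_space M \<and>
     (\<forall>t\<ge>0. X t \<in> measurable M (count_space UNIV)) \<and>
     (\<forall>\<omega>\<in>space M. \<forall>t\<ge>0. \<forall>\<^sub>F u in at_right t. X u \<omega> = X t \<omega>) \<and>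
     (\<exists>P. transition_semigroup P Q \<and>
        (\<forall>n (\<tau> :: nat \<Rightarrow> real) (x :: nat \<Rightarrow> 's).
           0 \<le> \<tau> 0 \<longrightarrow> (\<forall>k\<le>n. \<tau> k < \<tau> (Suc k)) \<longrightarrow>
           0 < \<P>(\<omega> in M. \<forall>k\<le>n. X (\<tau> k) \<omega> = x k) \<longrightarrow>
           \<P>(\<omega> in M. X (\<tau> (Suc n)) \<omega> = x (Suc n) \<bar> \<forall>k\<le>n. X (\<tau> k) \<omega> = x k)
             = P (\<tau> (Suc n) - \<tau> n) $ x n $ x (Suc n)))"

text \<open>The conditional law given \<open>X 0 = i\<close>; it is meaningful only if this event has
  positive probability.\<close>

definition started_at :: "'w measure \<Rightarrow> (real \<Rightarrow> 'w \<Rightarrow> 's) \<Rightarrow> 's \<Rightarrow> 'w measure" where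
  "started_at M X i = uniform_measure M {\<omega> \<in> space M. X 0 \<omega> = i}"

text \<open>The infimum is \<open>\<infinity>\<close> on paths that never visit \<open>j\<close>.\<close>

definition hitting_time :: "(real \<Rightarrow> 'w \<Rightarrow> 's) \<Rightarrow> 's \<Rightarrow> 'w \<Rightarrow> ennreal" where
  "hitting_time X j \<omega> = (INF t\<in>{t. 0 \<le> t \<and> X t \<omega> = j}. ennreal t)"

definition occupation_time :: "(real \<Rightarrow> 'w \<Rightarrow> 's) \<Rightarrow> 's \<Rightarrow> real \<Rightarrow> 'w \<Rightarrow> real" where
  "occupation_time X j t \<omega> = (LBINT u:{0..t}. indicat_real {u. X u \<omega> = j} u)"

end

(* The matrix 1 pi^T - Q is invertible; its inverse Z, the fundamental matrix, satisfies
   Q Z = 1 pi^T - I, Z 1 = 1 and pi Z = pi. Integrating d/dt P(t) Z = P(t) Q Z gives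
   E_j[M_j(t)] = t pi_j + Z_jj - (P(t) Z)_jj, and P(t) tends to 1 pi^T, so the right-hand side of
   the identity is trace Z - 1. For fixed j, the function v(x) = Z_jj - Z_xj vanishes at j and has
   drift (Q v)(x) = - pi_j off j. Observing the chain at multiples of a step 2^-n and telescoping
   shows that v(i) is, up to a relative error vanishing with n, pi_j times the mean hitting time
   of j by this skeleton; by right-continuity the skeleton hitting times decrease to theta_j.
   Hence pi_j E_i[theta_j] = Z_jj - Z_ij, and summing over j gives trace Z - 1 for every i. *)

theory Submission
  imports Defs
begin

section \<open>The transition semigroup and its derivative\<close>

text \<open>The obstacle is that the Markov property is given only along finitely many deterministic
  times, so \<open>hitting_time\<close> is not directly accessible to the strong Markov property or
  to optional stopping. On a grid of step \<delta>, avoiding j up to step k depends on k + 1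
  coordinates and splits into finitely many cylinders, for which the given property is enough. The
  price is that P(\<delta>) is only 1 + \<delta> Q + o(\<delta>): away from j, v loses between
  (\<pi>_j - \<eta>) \<delta> and (\<pi>_j + \<eta>) \<delta> per step, so equality appears only as
  \<eta> tends to 0. Steps 2^-n make the grids nested, which turns the limit in n into decreasing
  monotone convergence; the finite mean that this requires comes from the drift bounds themselves.
  The normalisation v(j) = 0 allows the chain to be killed at j, since the killed mass then
  contributes nothing. Q is singular because it annihilates constants; the rank-one term in 1
  \<pi>^T - Q repairs exactly this defect.\<close>

lemma matrix_diff_ldistrib: "A ** (B - C) = A ** B - A ** C"
  for A :: "'a::ring_1^'n::finite^'m"
  by (simp add: vec_eq_iff matrix_matrix_mult_def right_diff_distrib sum_subtractf)

lemma matrix_diff_rdistrib: "(A - B) ** C = A ** C - B ** C"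
  for A :: "'a::ring_1^'n::finite^'m"
  by (simp add: vec_eq_iff matrix_matrix_mult_def left_diff_distrib sum_subtractf)

locale markov_semigroup =
  fixes P :: "real \<Rightarrow> real^'s::finite^'s" and Q :: "real^'s^'s"
  assumes semigroup: "transition_semigroup P Q"
begin

lemma nonneg: "0 \<le> t \<Longrightarrow> 0 \<le> P t $ i $ j"
  and row_sum: "0 \<le> t \<Longrightarrow> (\<Sum>j\<in>UNIV. P t $ i $ j) = 1"
  and at_zero: "P 0 = mat 1"
  and add: "0 \<le> s \<Longrightarrow> 0 \<le> t \<Longrightarrow> P (s + t) = P s ** P t"
  using semigroup by (auto simp: transition_semigroup_def)

lemma add_entry:
  "0 \<le> s \<Longrightarrow> 0 \<le> t \<Longrightarrow> P (s + t) $ i $ j = (\<Sum>k\<in>UNIV. P s $ i $ k * P t $ k $ j)"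
  by (simp add: add matrix_matrix_mult_def)

lemma le_one:
  assumes "0 \<le> t" shows "P t $ i $ j \<le> 1"
proof -
  have "P t $ i $ j \<le> (\<Sum>j\<in>UNIV. P t $ i $ j)"
    by (rule member_le_sum) (auto simp: nonneg assms)
  then show ?thesis by (simp add: row_sum assms)
qed

lemma slope: "((\<lambda>h. (P h - mat 1) $ i $ j / h) \<longlongrightarrow> Q $ i $ j) (at_right 0)"
proof -
  have "(P has_vector_derivative Q) (at_right 0)"
    using semigroup by (simp add: transition_semigroup_def)
  then have "((\<lambda>h. P h $ i $ j) has_vector_derivative Q $ i $ j) (at_right 0)"
    by (intro bounded_linear.has_vector_derivative[OF bounded_linear_vec_nth])
  then show ?thesis
    by (simp add: has_real_derivative_iff_has_vector_derivative[symmetric]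
        has_field_derivative_iff at_zero)
qed

lemma slope_vec: "((\<lambda>h. ((P h *v f) $ i - f $ i) / h) \<longlongrightarrow> (Q *v f) $ i) (at_right 0)"
proof -
  have "((\<lambda>h. \<Sum>j\<in>UNIV. (P h - mat 1) $ i $ j / h * f $ j) \<longlongrightarrow> (\<Sum>j\<in>UNIV. Q $ i $ j * f $ j))
      (at_right 0)"
    by (intro tendsto_sum tendsto_mult slope tendsto_const)
  moreover have "(\<Sum>j\<in>UNIV. (P h - mat 1) $ i $ j / h * f $ j) = ((P h *v f) $ i - f $ i) / h" for h
  proof -
    have "((P h - mat 1) *v f) $ i = (P h *v f) $ i - f $ i"
      by (simp add: matrix_vector_mult_diff_rdistrib)
    then have "(P h *v f) $ i - f $ i = (\<Sum>j\<in>UNIV. (P h - mat 1) $ i $ j * f $ j)"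
      by (simp add: matrix_vector_mult_def)
    then show ?thesis
      by (simp add: sum_divide_distrib)
  qed
  ultimately show ?thesis by (simp add: matrix_vector_mult_def)
qed

lemma tendsto_mat_1: "((\<lambda>h. P h $ i $ j) \<longlongrightarrow> mat 1 $ i $ j) (at_right 0)"
proof -
  have "((\<lambda>h. (P h - mat 1) $ i $ j / h * h + mat 1 $ i $ j) \<longlongrightarrow> Q $ i $ j * 0 + mat 1 $ i $ j) (at_right 0)"
    by (intro tendsto_intros slope)
  moreover have "\<forall>\<^sub>F h in at_right 0. (P h - mat 1) $ i $ j / h * h + mat 1 $ i $ j = P h $ i $ j"
    by (auto simp: eventually_at intro!: exI[of _ 1])
  ultimately have "((\<lambda>h. P h $ i $ j) \<longlongrightarrow> Q $ i $ j * 0 + mat 1 $ i $ j) (at_right 0)"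
    by (rule Lim_transform_eventually)
  then show ?thesis by simp
qed

text \<open>Factoring out the earlier of the two times treats y < u and y > u alike. The remaining
  increment runs over |y - u| from time 0, where the only differentiability assumption is
  made.\<close>

lemma diff_eq:
  assumes "0 \<le> u" "0 \<le> y"
  shows "P (max u y) $ i $ j - P (min u y) $ i $ j
    = (\<Sum>k\<in>UNIV. P (min u y) $ i $ k * (P \<bar>y - u\<bar> - mat 1) $ k $ j)"
proof -
  have "max u y = min u y + \<bar>y - u\<bar>" by auto
  then have "P (max u y) = P (min u y) ** P \<bar>y - u\<bar>"
    using assms by (simp add: add)
  then have "P (max u y) - P (min u y) = P (min u y) ** (P \<bar>y - u\<bar> - mat 1)"
    by (simp add: matrix_diff_ldistrib)
  then show ?thesis
    by (metis (no_types, lifting) matrix_matrix_mult_def vec_lambda_beta vector_minus_component sum.cong)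
qed

lemma filterlim_abs_at_right:
  "filterlim (\<lambda>y. \<bar>y - u\<bar>) (at_right (0::real)) (at u within S)"
proof -
  have "((\<lambda>y. \<bar>y - u\<bar>) \<longlongrightarrow> \<bar>u - u\<bar>) (at u within S)"
    by (intro tendsto_intros)
  then show ?thesis
    by (auto simp: filterlim_at eventually_at intro!: exI[of _ 1])
qed

text \<open>For y < u the left factor in \<open>diff_eq\<close> moves with y, so its continuity has
  to precede differentiation. Its entries lie in [0, 1], hence the increment is bounded by
  \<open>g\<close>, which depends on |y - u| alone.\<close>

lemma tendsto_min:
  assumes "0 \<le> u"
  shows "((\<lambda>y. P (min u y) $ i $ j) \<longlongrightarrow> P u $ i $ j) (at u within {0..})"
proof -
  define g where "g y = (\<Sum>k\<in>UNIV. \<bar>(P \<bar>y - u\<bar> - mat 1) $ k $ j\<bar>)" for y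
  have "((\<lambda>h. (P h - mat 1) $ k $ j) \<longlongrightarrow> 0) (at_right 0)" for k
    using tendsto_diff[OF tendsto_mat_1[of k j] tendsto_const[of "mat 1 $ k $ j"]] by simp
  from filterlim_compose[OF this filterlim_abs_at_right]
  have "((\<lambda>y. \<Sum>k\<in>UNIV. \<bar>(P \<bar>y - u\<bar> - mat 1) $ k $ j\<bar>) \<longlongrightarrow> (\<Sum>k\<in>(UNIV::'s set). 0)) (at u within {0..})"
    by (intro tendsto_sum tendsto_rabs_zero)
  then have g: "(g \<longlongrightarrow> 0) (at u within {0..})" by (simp add: g_def[abs_def])
  have "((\<lambda>y. P (min u y) $ i $ j - P u $ i $ j) \<longlongrightarrow> 0) (at u within {0..})"
  proof (rule Lim_null_comparison[OF _ g])
    have "norm (P (min u y) $ i $ j - P u $ i $ j) \<le> g y" if "0 \<le> y" for y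
    proof -
      have "norm (P (min u y) $ i $ j - P u $ i $ j) \<le> \<bar>P (max u y) $ i $ j - P (min u y) $ i $ j\<bar>"
        by (auto simp: max_def min_def)
      also have "\<dots> \<le> (\<Sum>k\<in>UNIV. \<bar>P (min u y) $ i $ k * (P \<bar>y - u\<bar> - mat 1) $ k $ j\<bar>)"
        using assms that by (subst diff_eq) (auto intro: sum_abs)
      also have "\<dots> \<le> g y"
        unfolding g_def abs_mult using assms that
        by (intro sum_mono mult_left_le_one_le) (auto simp: nonneg le_one)
      finally show ?thesis .
    qed
    then show "\<forall>\<^sub>F y in at u within {0..}. norm (P (min u y) $ i $ j - P u $ i $ j) \<le> g y"
      by (auto simp: eventually_at intro!: exI[of _ 1])
  qed
  then show ?thesis by (simp add: LIM_zero_iff)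
qed

text \<open>Kolmogorov's forward equation: divide \<open>diff_eq\<close> by |y - u| and let y tend
  to u. For y < u numerator and denominator both change sign.\<close>

lemma deriv:
  assumes "0 \<le> u"
  shows "((\<lambda>y. P y $ i $ j) has_real_derivative (P u ** Q) $ i $ j) (at u within {0..})"
proof -
  have "((\<lambda>y. \<Sum>k\<in>UNIV. P (min u y) $ i $ k * ((P \<bar>y - u\<bar> - mat 1) $ k $ j / \<bar>y - u\<bar>)) \<longlongrightarrow>
      (\<Sum>k\<in>UNIV. P u $ i $ k * Q $ k $ j)) (at u within {0..})"
    by (intro tendsto_sum tendsto_mult tendsto_min assms
        filterlim_compose[OF slope filterlim_abs_at_right])
  moreover have "\<forall>\<^sub>F y in at u within {0..}.
      (\<Sum>k\<in>UNIV. P (min u y) $ i $ k * ((P \<bar>y - u\<bar> - mat 1) $ k $ j / \<bar>y - u\<bar>))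
      = (P y $ i $ j - P u $ i $ j) / (y - u)"
  proof -
    have "(\<Sum>k\<in>UNIV. P (min u y) $ i $ k * ((P \<bar>y - u\<bar> - mat 1) $ k $ j / \<bar>y - u\<bar>))
      = (P y $ i $ j - P u $ i $ j) / (y - u)" if "0 \<le> y" "y \<noteq> u" for y
    proof -
      have "(\<Sum>k\<in>UNIV. P (min u y) $ i $ k * ((P \<bar>y - u\<bar> - mat 1) $ k $ j / \<bar>y - u\<bar>))
        = (P (max u y) $ i $ j - P (min u y) $ i $ j) / \<bar>y - u\<bar>"
        using diff_eq[OF assms that(1)] by (simp add: sum_divide_distrib)
      also have "\<dots> = (P y $ i $ j - P u $ i $ j) / (y - u)"
        using that by (cases "u < y") (auto simp: field_simps max_def min_def abs_if)
      finally show ?thesis .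
    qed
    then show ?thesis by (auto simp: eventually_at intro!: exI[of _ 1])
  qed
  ultimately have "((\<lambda>y. (P y $ i $ j - P u $ i $ j) / (y - u)) \<longlongrightarrow>
      (\<Sum>k\<in>UNIV. P u $ i $ k * Q $ k $ j)) (at u within {0..})"
    by (rule Lim_transform_eventually)
  then show ?thesis
    by (simp add: has_field_derivative_iff matrix_matrix_mult_def)
qed

text \<open>P(u) commutes with (P(h) - 1) / h, and this passes to the limit h to 0. It converts the
  forward equation into the backward one.\<close>

lemma commute:
  assumes "0 \<le> u" shows "P u ** Q = Q ** P u"
proof -
  have "(P u ** Q) $ i $ j = (Q ** P u) $ i $ j" for i j
  proof -
    have lim: "((\<lambda>h. \<Sum>k\<in>UNIV. P u $ i $ k * ((P h - mat 1) $ k $ j / h)) \<longlongrightarrow> (P u ** Q) $ i $ j) (at_right 0)"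
      unfolding matrix_matrix_mult_def vec_lambda_beta by (intro tendsto_intros slope)
    have "((\<lambda>h. \<Sum>k\<in>UNIV. (P h - mat 1) $ i $ k / h * P u $ k $ j) \<longlongrightarrow> (Q ** P u) $ i $ j) (at_right 0)"
      unfolding matrix_matrix_mult_def vec_lambda_beta by (intro tendsto_intros slope)
    moreover have ev: "\<forall>\<^sub>F h in at_right 0. (\<Sum>k\<in>UNIV. (P h - mat 1) $ i $ k / h * P u $ k $ j)
        = (\<Sum>k\<in>UNIV. P u $ i $ k * ((P h - mat 1) $ k $ j / h))"
    proof -
      have "(\<Sum>k\<in>UNIV. (P h - mat 1) $ i $ k / h * P u $ k $ j)
        = (\<Sum>k\<in>UNIV. P u $ i $ k * ((P h - mat 1) $ k $ j / h))" if "0 < h" for h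
      proof -
        have "P h ** P u = P u ** P h"
          using add[of h u] add[of u h] assms that by (simp add: add.commute)
        then have "(P h - mat 1) ** P u = P u ** (P h - mat 1)"
          by (simp add: matrix_diff_ldistrib matrix_diff_rdistrib)
        then have "((P h - mat 1) ** P u) $ i $ j / h = (P u ** (P h - mat 1)) $ i $ j / h" by simp
        then show ?thesis
          by (simp add: matrix_matrix_mult_def sum_divide_distrib)
      qed
      then show ?thesis by (auto simp: eventually_at intro!: exI[of _ 1])
    qed
    ultimately have "((\<lambda>h. \<Sum>k\<in>UNIV. P u $ i $ k * ((P h - mat 1) $ k $ j / h)) \<longlongrightarrow> (Q ** P u) $ i $ j) (at_right 0)"
      by (blast intro: Lim_transform_eventually)
    with lim show ?thesis
      by (intro tendsto_unique[OF trivial_limit_at_right_real])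
  qed
  then show ?thesis by (simp add: vec_eq_iff)
qed

text \<open>The derivative of \<pi> P(t) is \<pi> P(t) Q = \<pi> Q P(t) = 0, so \<pi> P(t) keeps its
  value at time 0.\<close>

lemma stationary:
  assumes "\<pi> v* Q = 0" "0 \<le> t"
  shows "\<pi> v* P t = \<pi>"
proof -
  have "(\<pi> v* P t) $ j = (\<pi> v* P 0) $ j" for j
  proof -
    have "((\<lambda>t. (\<pi> v* P t) $ j) has_real_derivative 0) (at u within {0..})" if "0 \<le> u" for u
    proof -
      have "((\<lambda>t. \<Sum>i\<in>UNIV. P t $ i $ j * \<pi> $ i) has_real_derivative
          (\<Sum>i\<in>UNIV. (P u ** Q) $ i $ j * \<pi> $ i)) (at u within {0..})"
        by (intro derivative_intros DERIV_cmult_right deriv that)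
      moreover have "(\<Sum>i\<in>UNIV. (P u ** Q) $ i $ j * \<pi> $ i) = (\<pi> v* (Q ** P u)) $ j"
        by (simp add: commute that vector_matrix_mult_def mult.commute)
      moreover have "(\<pi> v* (Q ** P u)) $ j = 0"
        by (simp add: assms(1) flip: vector_matrix_mul_assoc)
      ultimately show ?thesis by (simp add: vector_matrix_mult_def mult.commute)
    qed
    then have "\<exists>c. \<forall>u\<in>{0..}. (\<pi> v* P u) $ j = c"
      by (intro has_field_derivative_zero_constant) auto
    then show ?thesis using assms(2) by auto
  qed
  then show ?thesis by (simp add: vec_eq_iff at_zero)
qed

end

section \<open>Convergence to equilibrium and the fundamental matrix\<close>

context markov_semigroup
begin

text \<open>Diagonal entries are near 1 for short times, and a long time is a product of short ones.
  Off the diagonal, a positive rate makes P(h) positive for some small h < t, after which the chain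
  may sit at l for the time t - h.\<close>

lemma positive_step:
  assumes "0 < t" "k = l \<or> 0 < Q $ k $ l"
  shows "0 < P t $ k $ l"
proof -
  have small: "\<forall>\<^sub>F h in at_right 0. 0 < P h $ k $ k" for k
    by (rule order_tendstoD[OF tendsto_mat_1]) (simp add: mat_def)
  have diag: "0 < P t $ k $ k" if t: "0 < t" for t k
  proof -
    obtain b where b: "0 < b" "\<And>h. 0 < h \<Longrightarrow> h < b \<Longrightarrow> 0 < P h $ k $ k"
      using small[of k] by (auto simp: eventually_at_right_field)
    obtain n where n: "t / b < real n" using reals_Archimedean2 by blast
    have "0 < n" using n t b by (cases n) (auto simp: field_simps)
    define h where "h = t / real n"
    have h: "0 < h" "h < b" using n t b \<open>0 < n\<close> by (auto simp: h_def field_simps)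
    have "0 < P (real m * h) $ k $ k" for m
    proof (induction m)
      case 0
      then show ?case by (simp add: at_zero mat_def)
    next
      case (Suc m)
      have "0 < P (real m * h) $ k $ k * P h $ k $ k" using Suc b h by simp
      also have "\<dots> \<le> (\<Sum>l\<in>UNIV. P (real m * h) $ k $ l * P h $ l $ k)"
        by (rule member_le_sum) (use h in \<open>auto intro!: mult_nonneg_nonneg nonneg\<close>)
      also have "\<dots> = P (real m * h + h) $ k $ k" using h by (simp add: add_entry)
      finally show ?case by (simp add: algebra_simps)
    qed
    from this[of n] show ?thesis using \<open>0 < n\<close> by (simp add: h_def)
  qed
  show ?thesis
  proof (cases "k = l")
    case True
    then show ?thesis using diag assms by simp
  next
    case False
    with assms have "0 < Q $ k $ l" by simp
    with order_tendstoD(1)[OF slope this] False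
    have "\<forall>\<^sub>F h in at_right 0. 0 < P h $ k $ l / h" by (simp add: mat_def)
    then obtain b where b: "0 < b" "\<And>h. 0 < h \<Longrightarrow> h < b \<Longrightarrow> 0 < P h $ k $ l / h"
      by (auto simp: eventually_at_right_field)
    define h where "h = min t b / 2"
    have h: "0 < h" "h < b" "h < t" using b assms by (auto simp: h_def)
    have "0 < P h $ k $ l * P (t - h) $ l $ l"
      using b(2)[of h] h diag[of "t - h" l] by (simp add: zero_less_divide_iff)
    also have "\<dots> \<le> (\<Sum>m\<in>UNIV. P h $ k $ m * P (t - h) $ m $ l)"
      by (rule member_le_sum) (use h in \<open>auto intro!: mult_nonneg_nonneg nonneg\<close>)
    also have "\<dots> = P (h + (t - h)) $ k $ l" using h by (subst add_entry) auto
    finally show ?thesis by simp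
  qed
qed

text \<open>Induction along a path of positive rates: each edge spends half of the available time,
  which is why \<open>t\<close> is generalised.\<close>

lemma positive:
  assumes "irreducible_generator Q" "0 < t"
  shows "0 < P t $ i $ j"
proof -
  have "(i, j) \<in> {(k, l). k \<noteq> l \<and> 0 < Q $ k $ l}\<^sup>*"
    using assms by (simp add: irreducible_generator_def)
  then show ?thesis using assms(2)
  proof (induction arbitrary: t)
    case base
    then show ?case by (simp add: positive_step)
  next
    case (step k l)
    have half: "0 < t / 2" using step.prems by simp
    have "0 < P (t/2) $ i $ k * P (t/2) $ k $ l"
      using step.IH[OF half] positive_step[OF half, of k l] step.hyps by simp
    also have "\<dots> \<le> (\<Sum>m\<in>UNIV. P (t/2) $ i $ m * P (t/2) $ m $ l)"
      by (rule member_le_sum) (use half in \<open>simp_all add: nonneg\<close>)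
    also have "\<dots> = P (t/2 + t/2) $ i $ l" using half by (subst add_entry) auto
    finally show ?case by simp
  qed
qed

lemma average_bounds:
  assumes "0 \<le> t" "\<And>k. a \<le> w $ k" "\<And>k. w $ k \<le> b"
  shows "a \<le> (P t *v w) $ i" "(P t *v w) $ i \<le> b"
proof -
  have "a = (\<Sum>k\<in>UNIV. P t $ i $ k * a)" "b = (\<Sum>k\<in>UNIV. P t $ i $ k * b)"
    using assms(1) by (simp_all add: row_sum flip: sum_distrib_right)
  moreover have "(\<Sum>k\<in>UNIV. P t $ i $ k * a) \<le> (P t *v w) $ i"
    "(P t *v w) $ i \<le> (\<Sum>k\<in>UNIV. P t $ i $ k * b)"
    unfolding matrix_vector_mult_def vec_lambda_beta
    by (intro sum_mono mult_left_mono assms nonneg)+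
  ultimately show "a \<le> (P t *v w) $ i" "(P t *v w) $ i \<le> b" by linarith+
qed

text \<open>Doeblin's argument: averaging with weights that are all at least \<open>\<epsilon>\<close> shrinks the
  oscillation by the factor \<open>1 - \<epsilon>\<close>.\<close>

lemma contraction:
  assumes "0 \<le> t" "\<And>i j. \<epsilon> \<le> P t $ i $ j" "0 \<le> \<epsilon>" "\<And>k. a \<le> w $ k" "\<And>k. w $ k \<le> b"
  obtains a' b' where "\<And>k. a' \<le> (P t *v w) $ k" "\<And>k. (P t *v w) $ k \<le> b'"
    "b' - a' \<le> (1 - \<epsilon>) * (b - a)"
proof -
  \<comment> \<open>The given bounds a and b need not be attained. The exact extrema are used
    because the gain of \<epsilon> * (hi - lo) comes from the single term at a maximiser
    \<open>m\<close>.\<close>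
  define lo where "lo = Min (range (($) w))"
  define hi where "hi = Max (range (($) w))"
  have lohi: "lo \<le> w $ k" "w $ k \<le> hi" for k by (auto simp: lo_def hi_def)
  have "lo \<in> range (($) w)" unfolding lo_def by (rule Min_in) auto
  then have "a \<le> lo" using assms(4) by (metis imageE)
  have "hi \<in> range (($) w)" unfolding hi_def by (rule Max_in) auto
  then obtain m where m: "hi = w $ m" by auto
  then have "hi \<le> b" using assms(5) by simp
  have "lo + \<epsilon> * (hi - lo) \<le> (P t *v w) $ i" for i
  proof -
    have "\<epsilon> * (hi - lo) \<le> P t $ i $ m * (w $ m - lo)"
      unfolding m using lohi(1)[of m] by (intro mult_right_mono assms(2)) simp
    also have "\<dots> \<le> (\<Sum>k\<in>UNIV. P t $ i $ k * (w $ k - lo))"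
      by (rule member_le_sum) (simp_all add: nonneg assms(1) lohi(1))
    also have "\<dots> = (P t *v w) $ i - lo"
      using assms(1)
      by (simp add: right_diff_distrib sum_subtractf row_sum matrix_vector_mult_def
          flip: sum_distrib_right)
    finally show ?thesis by simp
  qed
  moreover have "(P t *v w) $ i \<le> hi" for i
    by (rule average_bounds(2)[OF assms(1) lohi])
  moreover have "hi - (lo + \<epsilon> * (hi - lo)) \<le> (1 - \<epsilon>) * (b - a)"
  proof -
    have "\<epsilon> \<le> 1" using assms(2)[of m m] le_one[OF assms(1), of m m] by linarith
    then have "(1 - \<epsilon>) * (hi - lo) \<le> (1 - \<epsilon>) * (b - a)"
      using \<open>a \<le> lo\<close> \<open>hi \<le> b\<close> by (intro mult_left_mono) auto
    then show ?thesis by (simp add: algebra_simps)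
  qed
  ultimately show ?thesis by (rule that)
qed

text \<open>The oscillation of column j of P(n) is at most (1 - \<epsilon>)^n. Both P(t)_ij and
  \<pi>_j, the latter as the \<pi>-average of column j of P(t), lie in the same interval of that
  length.\<close>

lemma convergence:
  assumes irr: "irreducible_generator Q" and st: "stationary_distribution Q \<pi>"
  shows "((\<lambda>t. P t $ i $ j) \<longlongrightarrow> \<pi> $ j) at_top"
proof -
  \<comment> \<open>The Doeblin constant is the smallest entry of P(1), positive by irreducibility;
    taking the minimum uses that there are finitely many states.\<close>
  define \<epsilon> where "\<epsilon> = Min (range (\<lambda>p. P 1 $ fst p $ snd p))"
  have fin: "finite (range (\<lambda>p. P 1 $ fst p $ snd p))"
    by (rule finite_imageI) (rule finite)
  have le: "\<epsilon> \<le> P 1 $ i $ j" for i j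
    using Min_le[OF fin rangeI[of _ "(i, j)"]] unfolding \<epsilon>_def fst_conv snd_conv .
  have "\<epsilon> \<in> range (\<lambda>p. P 1 $ fst p $ snd p)"
    unfolding \<epsilon>_def by (rule Min_in[OF fin]) blast
  then obtain p where "\<epsilon> = P 1 $ fst p $ snd p" by blast
  then have pos: "0 < \<epsilon>" using positive[OF irr zero_less_one] by metis
  have le1: "\<epsilon> \<le> 1" using le[of i j] le_one[of 1 i j] by linarith
  define w where "w t = P t *v axis j 1" for t
  have w: "w t $ k = P t $ k $ j" for t k
    by (simp add: w_def matrix_vector_mult_basis column_def)
  have w_add: "w (s + t) = P s *v w t" if "0 \<le> s" "0 \<le> t" for s t
    using that by (simp add: w_def add matrix_vector_mul_assoc)
  have osc: "\<exists>a b. (\<forall>k. a \<le> w (real n) $ k \<and> w (real n) $ k \<le> b) \<and> b - a \<le> (1 - \<epsilon>) ^ n" for n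
  proof (induction n)
    case 0
    show ?case
      by (intro exI[of _ 0] exI[of _ 1]) (simp add: w at_zero mat_def)
  next
    case (Suc n)
    then obtain a b where ab: "\<And>k. a \<le> w (real n) $ k" "\<And>k. w (real n) $ k \<le> b"
      "b - a \<le> (1 - \<epsilon>) ^ n" by blast
    obtain a' b' where ab': "\<And>k. a' \<le> (P 1 *v w (real n)) $ k" "\<And>k. (P 1 *v w (real n)) $ k \<le> b'"
      "b' - a' \<le> (1 - \<epsilon>) * (b - a)"
      by (rule contraction[OF zero_le_one le less_imp_le[OF pos] ab(1,2)]) (rule that)
    have "b' - a' \<le> (1 - \<epsilon>) * (1 - \<epsilon>) ^ n"
      using ab'(3) mult_left_mono[OF ab(3), of "1 - \<epsilon>"] le1 by simp
    moreover have "w (real (Suc n)) = P 1 *v w (real n)"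
      using w_add[of 1 "real n"] by simp
    ultimately show ?case
      using ab'(1,2) by (intro exI[of _ a'] exI[of _ b']) simp
  qed
  have bound: "norm (P t $ i $ j - \<pi> $ j) \<le> (1 - \<epsilon>) ^ nat \<lfloor>t\<rfloor>" if t: "0 \<le> t" for t
  proof -
    \<comment> \<open>Only whole unit steps contract; over the remaining time t - n averaging at
      least preserves the bounds.\<close>
    define n where "n = nat \<lfloor>t\<rfloor>"
    have n: "real n \<le> t" using t by (simp add: n_def)
    obtain a b where ab: "\<And>k. a \<le> w (real n) $ k" "\<And>k. w (real n) $ k \<le> b"
      "b - a \<le> (1 - \<epsilon>) ^ n" using osc by blast
    have wt: "a \<le> w t $ k" "w t $ k \<le> b" for k
      using average_bounds[of "t - real n" a "w (real n)" b k] w_add[of "t - real n" "real n"] ab n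
      by auto
    have sum1: "(\<Sum>k\<in>UNIV. \<pi> $ k) = 1" and ge0: "\<And>k. 0 \<le> \<pi> $ k"
      using st by (auto simp: stationary_distribution_def)
    have "\<pi> v* P t = \<pi>" using st t by (intro stationary) (auto simp: stationary_distribution_def)
    then have "\<pi> $ j = (\<pi> v* P t) $ j" by simp
    then have eq: "\<pi> $ j = (\<Sum>k\<in>UNIV. \<pi> $ k * w t $ k)"
      by (simp add: w vector_matrix_mult_def mult.commute)
    have "(\<Sum>k\<in>UNIV. \<pi> $ k * a) \<le> \<pi> $ j" "\<pi> $ j \<le> (\<Sum>k\<in>UNIV. \<pi> $ k * b)"
      unfolding eq by (intro sum_mono mult_left_mono wt ge0)+
    then have "a \<le> \<pi> $ j" "\<pi> $ j \<le> b" by (simp_all add: sum1 flip: sum_distrib_right)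
    then show ?thesis using wt[of i] ab(3) by (auto simp: w n_def abs_le_iff)
  qed
  have "((\<lambda>t. P t $ i $ j - \<pi> $ j) \<longlongrightarrow> 0) at_top"
  proof (rule Lim_null_comparison)
    show "\<forall>\<^sub>F t in at_top. norm (P t $ i $ j - \<pi> $ j) \<le> (1 - \<epsilon>) ^ nat \<lfloor>t\<rfloor>"
      using bound by (intro eventually_at_top_linorderI[of 0])
    have "filterlim (\<lambda>t::real. nat \<lfloor>t\<rfloor>) sequentially at_top"
      by (intro filterlim_compose[OF filterlim_nat_sequentially] filterlim_floor_sequentially)
    from filterlim_compose[OF LIMSEQ_power_zero this, of "1 - \<epsilon>"]
    show "((\<lambda>t::real. (1 - \<epsilon>) ^ nat \<lfloor>t\<rfloor>) \<longlongrightarrow> 0) at_top"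
      using pos le1 by simp
  qed
  then show ?thesis by (simp add: LIM_zero_iff)
qed

end

section \<open>Irreducibility and the kernel of the generator\<close>

text \<open>A zero of \<pi> propagates backwards along positive rates: where \<pi>_l = 0, balance at
  l is a vanishing sum of nonnegative terms. By irreducibility \<pi> would vanish everywhere,
  against total mass 1.\<close>

lemma stationary_distribution_pos:
  assumes irr: "irreducible_generator Q" and st: "stationary_distribution Q \<pi>"
  shows "0 < \<pi> $ j"
proof (rule ccontr)
  have ge0: "0 \<le> \<pi> $ k" for k using st by (simp add: stationary_distribution_def)
  have gen: "k \<noteq> l \<Longrightarrow> 0 \<le> Q $ k $ l" for k l
    using irr by (simp add: irreducible_generator_def generator_matrix_def)
  have step: "\<pi> $ k = 0" if "\<pi> $ l = 0" "k \<noteq> l" "0 < Q $ k $ l" for k l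
  proof -
    \<comment> \<open>The diagonal rate may be negative, but its term vanishes because \<pi>_l =
      0.\<close>
    have nn: "0 \<le> \<pi> $ m * Q $ m $ l" for m
      using ge0[of m] gen[of m l] that(1) by (cases "m = l") auto
    have "(\<Sum>m\<in>UNIV. \<pi> $ m * Q $ m $ l) = (\<pi> v* Q) $ l"
      by (simp add: vector_matrix_mult_def mult.commute)
    also have "\<dots> = 0" using st by (simp add: stationary_distribution_def)
    finally have "\<pi> $ k * Q $ k $ l = 0"
      using nn by (simp add: sum_nonneg_eq_0_iff)
    then show ?thesis using that(3) by simp
  qed
  assume "\<not> 0 < \<pi> $ j"
  then have "\<pi> $ j = 0" using ge0[of j] by simp
  have "\<pi> $ i = 0" for i
  proof -
    have "(i, j) \<in> {(k, l). k \<noteq> l \<and> 0 < Q $ k $ l}\<^sup>*"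
      using irr by (simp add: irreducible_generator_def)
    then show ?thesis
      by (induction rule: converse_rtrancl_induct) (auto intro: step \<open>\<pi> $ j = 0\<close>)
  qed
  then show False using st by (simp add: stationary_distribution_def)
qed

text \<open>The maximum principle: at a maximiser the weighted deficits from the maximum sum to 0
  and are nonnegative, so the maximum spreads along every positive rate.\<close>

lemma harmonic_imp_constant:
  fixes x :: "real^'s::finite"
  assumes irr: "irreducible_generator Q" and "Q *v x = 0"
  shows "x $ i = x $ j"
proof -
  have gen: "k \<noteq> l \<Longrightarrow> 0 \<le> Q $ k $ l" "(\<Sum>l\<in>UNIV. Q $ k $ l) = 0" for k l
    using irr by (auto simp: irreducible_generator_def generator_matrix_def)
  define hi where "hi = Max (range (($) x))"
  have hi: "x $ k \<le> hi" for k by (auto simp: hi_def)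
  have "hi \<in> range (($) x)" unfolding hi_def by (rule Max_in) auto
  then obtain m where m: "x $ m = hi" by auto
  have step: "x $ l = hi" if "x $ k = hi" "k \<noteq> l" "0 < Q $ k $ l" for k l
  proof -
    have nn: "0 \<le> Q $ k $ m * (hi - x $ m)" for m
      using hi[of m] gen(1)[of k m] that(1) by (cases "m = k") auto
    have "(\<Sum>l\<in>UNIV. Q $ k $ l * (hi - x $ l)) = (\<Sum>l\<in>UNIV. Q $ k $ l) * hi - (Q *v x) $ k"
      by (simp add: right_diff_distrib sum_subtractf sum_distrib_right matrix_vector_mult_def)
    also have "\<dots> = 0" by (simp add: gen(2) assms(2))
    finally have "Q $ k $ l * (hi - x $ l) = 0"
      using nn by (simp add: sum_nonneg_eq_0_iff)
    then show ?thesis using that(3) by simp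
  qed
  have "x $ k = hi" for k
  proof -
    have "(m, k) \<in> {(k, l). k \<noteq> l \<and> 0 < Q $ k $ l}\<^sup>*"
      using irr by (simp add: irreducible_generator_def)
    then show ?thesis by induction (use m step in blast)+
  qed
  then show ?thesis by simp
qed

text \<open>For invertibility, let (W - Q) x = 0. Pairing with \<pi> removes Q and gives \<pi> . x =
  0, hence W x = 0 and then Q x = 0; so x is constant with \<pi>-average 0. The last two identities
  follow because 1 and \<pi> are right and left fixed vectors of W - Q.\<close>

lemma fundamental_matrix:
  fixes Q :: "real^'s::finite^'s"
  assumes irr: "irreducible_generator Q" and st: "stationary_distribution Q \<pi>"
  obtains Z :: "real^'s^'s" where
    "\<And>i j. (Q ** Z) $ i $ j = \<pi> $ j - mat 1 $ i $ j"
    "\<And>i. (\<Sum>j\<in>UNIV. Z $ i $ j) = 1"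
    "\<And>j. (\<Sum>i\<in>UNIV. \<pi> $ i * Z $ i $ j) = \<pi> $ j"
proof -
  define W :: "real^'s^'s" where "W = (\<chi> i j. \<pi> $ j)"
  have sum1: "(\<Sum>k\<in>UNIV. \<pi> $ k) = 1" and \<pi>Q: "\<pi> v* Q = 0"
    using st by (auto simp: stationary_distribution_def)
  have Q1: "Q *v 1 = 0"
    using irr by (simp add: irreducible_generator_def generator_matrix_def matrix_vector_mult_def vec_eq_iff)
  have \<pi>W: "\<pi> v* W = \<pi>"
    by (simp add: W_def vector_matrix_mult_def vec_eq_iff sum1 flip: sum_distrib_right)
  have W1: "W *v 1 = 1"
    by (simp add: W_def matrix_vector_mult_def vec_eq_iff sum1)
  have "x = 0" if x: "(W - Q) *v x = 0" for x
  proof -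
    have eq: "Q *v x = W *v x" using x by (simp add: matrix_vector_mult_diff_rdistrib)
    have "\<pi> v* (W - Q) = \<pi>" by (simp add: vector_matrix_mult_diff_rdistrib \<pi>W \<pi>Q)
    then have "\<pi> \<bullet> x = (\<pi> v* (W - Q)) \<bullet> x" by simp
    also have "\<dots> = \<pi> \<bullet> ((W - Q) *v x)"
      by (metis dot_lmul_matrix)
    finally have \<pi>x: "\<pi> \<bullet> x = 0" using x by simp
    then have "W *v x = 0"
      by (simp add: W_def matrix_vector_mult_def vec_eq_iff inner_vec_def)
    then have const: "x $ i = x $ j" for i j
      using harmonic_imp_constant[OF irr] eq by simp
    have "x $ i = 0" for i
    proof -
      have "\<pi> \<bullet> x = (\<Sum>k\<in>UNIV. \<pi> $ k * x $ i)"
        unfolding inner_vec_def using const by (intro sum.cong) auto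
      then show ?thesis using \<pi>x by (simp add: sum1 flip: sum_distrib_right)
    qed
    then show ?thesis by (simp add: vec_eq_iff)
  qed
  then obtain Z where Z: "Z ** (W - Q) = mat 1"
    using matrix_left_invertible_ker by blast
  then have Z': "(W - Q) ** Z = mat 1" by (simp add: matrix_left_right_inverse)
  have "\<pi> v* Z = (\<pi> v* (W - Q)) v* Z" by (simp add: vector_matrix_mult_diff_rdistrib \<pi>W \<pi>Q)
  also have "\<dots> = \<pi>" by (simp add: vector_matrix_mul_assoc Z')
  finally have \<pi>Z: "\<pi> v* Z = \<pi>" .
  have "Z *v 1 = Z *v ((W - Q) *v 1)" by (simp add: matrix_vector_mult_diff_rdistrib W1 Q1)
  also have "\<dots> = 1" by (simp add: matrix_vector_mul_assoc Z)
  finally have Z1: "Z *v 1 = 1" .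
  show ?thesis
  proof
    show "(\<Sum>j\<in>UNIV. Z $ i $ j) = 1" for i
      using Z1 by (simp add: vec_eq_iff matrix_vector_mult_def)
    show *: "(\<Sum>i\<in>UNIV. \<pi> $ i * Z $ i $ j) = \<pi> $ j" for j
      using \<pi>Z by (simp add: vec_eq_iff vector_matrix_mult_def mult.commute)
    show "(Q ** Z) $ i $ j = \<pi> $ j - mat 1 $ i $ j" for i j
    proof -
      \<comment> \<open>Every row of W is \<pi>, so every row of W Z is \<pi> Z = \<pi>.\<close>
      have "(W ** Z) $ i $ j = \<pi> $ j"
        by (simp add: W_def matrix_matrix_mult_def *)
      moreover have "(W ** Z) $ i $ j - (Q ** Z) $ i $ j = mat 1 $ i $ j"
        using Z' by (simp add: matrix_diff_rdistrib flip: vector_minus_component)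
      ultimately show ?thesis by simp
    qed
  qed
qed

section \<open>The integrated semigroup\<close>

context markov_semigroup
begin

text \<open>The right-hand side, as a function \<open>F\<close> of time, is a primitive: P Q Z = P
  (1 \<pi>^T - 1) = 1 \<pi>^T - P since rows of P sum to 1. It vanishes at 0.\<close>

lemma integral_diagonal:
  assumes "\<And>i j. (Q ** Z) $ i $ j = \<pi> $ j - mat 1 $ i $ j" "0 \<le> t"
  shows "(LBINT u:{0..t}. P u $ i $ j) = t * \<pi> $ j + Z $ i $ j - (P t ** Z) $ i $ j"
proof -
  define F where "F u = u * \<pi> $ j + Z $ i $ j - (P u ** Z) $ i $ j" for u
  have der: "(F has_real_derivative P u $ i $ j) (at u within {0..})" if u: "0 \<le> u" for u
  proof -
    have "((\<lambda>u. \<Sum>k\<in>UNIV. P u $ i $ k * Z $ k $ j) has_real_derivative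
        (\<Sum>k\<in>UNIV. (P u ** Q) $ i $ k * Z $ k $ j)) (at u within {0..})"
      by (intro DERIV_sum DERIV_cmult_right deriv u)
    moreover have "(\<Sum>k\<in>UNIV. (P u ** Q) $ i $ k * Z $ k $ j) = \<pi> $ j - P u $ i $ j"
    proof -
      have "(\<Sum>k\<in>UNIV. (P u ** Q) $ i $ k * Z $ k $ j) = (P u ** (Q ** Z)) $ i $ j"
        by (simp add: matrix_mul_assoc) (simp add: matrix_matrix_mult_def)
      also have "\<dots> = (\<Sum>k\<in>UNIV. P u $ i $ k * \<pi> $ j) - (P u ** mat 1) $ i $ j"
        by (simp only: matrix_matrix_mult_def[of "P u"] vec_lambda_beta assms(1) right_diff_distrib sum_subtractf)
      finally show ?thesis using u by (simp add: row_sum flip: sum_distrib_right)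
    qed
    ultimately have "((\<lambda>u. (P u ** Z) $ i $ j) has_real_derivative \<pi> $ j - P u $ i $ j) (at u within {0..})"
      by (simp add: matrix_matrix_mult_def)
    from DERIV_diff[OF DERIV_add[OF DERIV_cmult_right[OF DERIV_ident, of "\<pi> $ j"] DERIV_const[of "Z $ i $ j"]] this]
    show ?thesis by (simp add: F_def[abs_def])
  qed
  have "(\<integral>u. indicat_real {0..t} u *\<^sub>R P u $ i $ j \<partial>lborel) = F t - F 0"
  proof (rule integral_FTC_Icc[OF assms(2)])
    show "(F has_vector_derivative P u $ i $ j) (at u within {0..t})" if "0 \<le> u" "u \<le> t" for u
      using has_field_derivative_subset[OF der[OF that(1)], of "{0..t}"]
      by (auto simp: has_real_derivative_iff_has_vector_derivative)
    show "continuous_on {0..t} (\<lambda>u. P u $ i $ j)"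
    proof (rule continuous_on_subset)
      show "continuous_on {0..} (\<lambda>u. P u $ i $ j)"
        using deriv by (intro DERIV_continuous_on) auto
    qed auto
  qed
  then show ?thesis by (simp add: set_lebesgue_integral_def F_def at_zero)
qed

end

section \<open>The chain at finitely many times\<close>

text \<open>Names one semigroup out of the existential in the definition of the chain.
  \<open>initial_pos\<close> makes \<open>started_at\<close> a probability measure for every
  starting state.\<close>

locale markov_chain = prob_space M + markov_semigroup P Q
  for M :: "'w measure" and P :: "real \<Rightarrow> real^'s::finite^'s" and Q :: "real^'s^'s" +
  fixes X :: "real \<Rightarrow> 'w \<Rightarrow> 's"
  assumes measurable_X: "0 \<le> t \<Longrightarrow> X t \<in> measurable M (count_space UNIV)"
    and right_continuous: "\<omega> \<in> space M \<Longrightarrow> 0 \<le> t \<Longrightarrow> \<forall>\<^sub>F u in at_right t. X u \<omega> = X t \<omega>"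
    and markov: "0 \<le> \<tau> 0 \<Longrightarrow> (\<And>k. k \<le> n \<Longrightarrow> \<tau> k < \<tau> (Suc k)) \<Longrightarrow>
       0 < \<P>(\<omega> in M. \<forall>k\<le>n. X (\<tau> k) \<omega> = x k) \<Longrightarrow>
       \<P>(\<omega> in M. X (\<tau> (Suc n)) \<omega> = x (Suc n) \<bar> \<forall>k\<le>n. X (\<tau> k) \<omega> = x k)
         = P (\<tau> (Suc n) - \<tau> n) $ x n $ x (Suc n)"
    and initial_pos: "0 < \<P>(\<omega> in M. X 0 \<omega> = i)"
begin

lemma event_X:
  assumes "0 \<le> t" shows "{\<omega> \<in> space M. X t \<omega> = i} \<in> events"
proof -
  have "{\<omega> \<in> space M. X t \<omega> = i} = X t -` {i} \<inter> space M" by blast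
  then show ?thesis using measurable_sets[OF measurable_X[OF assms], of "{i}"] by simp
qed

lemma event_path:
  fixes \<tau> :: "nat \<Rightarrow> real"
  assumes "\<And>k. k \<le> n \<Longrightarrow> 0 \<le> \<tau> k"
  shows "{\<omega> \<in> space M. \<forall>k\<le>n. X (\<tau> k) \<omega> = x k} \<in> events"
proof -
  have "{\<omega> \<in> space M. \<forall>k\<in>{..n}. X (\<tau> k) \<omega> = x k} \<in> events"
  proof (rule sets.sets_Collect_finite_All)
    fix k assume "k \<in> {..n}"
    then show "{\<omega> \<in> space M. X (\<tau> k) \<omega> = x k} \<in> events"
      unfolding atMost_iff by (rule event_X[OF assms])
  qed (rule finite_atMost)
  then show ?thesis unfolding Ball_def atMost_iff .
qed

text \<open>The Markov property in product form, which also covers histories of probability 0, where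
  both sides vanish; this is what can be summed over histories.\<close>

lemma prob_path_Suc:
  assumes "0 \<le> \<tau> 0" "\<And>k. k \<le> n \<Longrightarrow> \<tau> k < \<tau> (Suc k)" "\<And>k. k \<le> n \<Longrightarrow> 0 \<le> \<tau> k"
  shows "\<P>(\<omega> in M. (\<forall>k\<le>n. X (\<tau> k) \<omega> = x k) \<and> X (\<tau> (Suc n)) \<omega> = y)
    = \<P>(\<omega> in M. \<forall>k\<le>n. X (\<tau> k) \<omega> = x k) * P (\<tau> (Suc n) - \<tau> n) $ x n $ y"
proof -
  define H where "H \<omega> \<longleftrightarrow> (\<forall>k\<le>n. X (\<tau> k) \<omega> = x k)" for \<omega>
  have H: "{\<omega> \<in> space M. H \<omega>} \<in> events"
    unfolding H_def by (rule event_path) (rule assms(3))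
  \<comment> \<open>A single function describes both history and next state in
    \<open>markov\<close>; changing it at \<open>Suc n\<close> leaves the history intact.\<close>
  define x' where "x' = x(Suc n := y)"
  have H': "(\<forall>k\<le>n. X (\<tau> k) \<omega> = x' k) \<longleftrightarrow> H \<omega>" for \<omega>
    by (auto simp: H_def x'_def)
  show ?thesis
  proof (cases "\<P>(\<omega> in M. H \<omega>) = 0")
    case True
    have "\<P>(\<omega> in M. H \<omega> \<and> X (\<tau> (Suc n)) \<omega> = y) \<le> \<P>(\<omega> in M. H \<omega>)"
      by (intro finite_measure_mono H) blast
    then show ?thesis
      using True measure_nonneg[of M "{\<omega> \<in> space M. H \<omega> \<and> X (\<tau> (Suc n)) \<omega> = y}"]
      unfolding H_def[symmetric] by simp
  next
    case False
    then have pos: "0 < \<P>(\<omega> in M. H \<omega>)" by (simp add: zero_less_measure_iff)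
    have "\<P>(\<omega> in M. X (\<tau> (Suc n)) \<omega> = y \<bar> H \<omega>) = P (\<tau> (Suc n) - \<tau> n) $ x n $ y"
      using markov[OF assms(1,2), of n x', unfolded H', OF _ pos] by (simp add: x'_def)
    then show ?thesis
      using False unfolding H_def[symmetric] cond_prob_def
      by (simp add: divide_eq_eq conj_commute mult.commute)
  qed
qed

text \<open>An event determined by k + 1 grid values is a finite disjoint union of cylinders
  \<open>W p\<close>. All those counted end in x, so they share the factor P(\<delta>)_xy.\<close>

lemma prob_skeleton_Suc:
  assumes "0 < \<delta>" and G: "\<And>f g. (\<And>m. m \<le> k \<Longrightarrow> f m = g m) \<Longrightarrow> G f = G g"
  shows "\<P>(\<omega> in M. (G (\<lambda>m. X (real m * \<delta>) \<omega>) \<and> X (real k * \<delta>) \<omega> = x) \<and> X (real (Suc k) * \<delta>) \<omega> = y)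
    = \<P>(\<omega> in M. G (\<lambda>m. X (real m * \<delta>) \<omega>) \<and> X (real k * \<delta>) \<omega> = x) * P \<delta> $ x $ y"
proof -
  \<comment> \<open>Extensionality fixes the values beyond k: \<open>F\<close> is finite, and
    distinct members differ at some index up to k, so their cylinders are disjoint.\<close>
  define F where "F = {p \<in> {..k} \<rightarrow>\<^sub>E (UNIV :: 's set). G p \<and> p k = x}"
  define W where "W p = {\<omega> \<in> space M. \<forall>m\<le>k. X (real m * \<delta>) \<omega> = p m}" for p
  define E where "E = {\<omega> \<in> space M. X (real (Suc k) * \<delta>) \<omega> = y}"
  have fin: "finite F"
    by (rule finite_subset[of _ "{..k} \<rightarrow>\<^sub>E UNIV"]) (simp_all add: F_def finite_PiE Collect_mono_iff)
  have W: "W p \<in> events" for p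
    unfolding W_def by (rule event_path) (use assms(1) in simp)
  have E: "E \<in> events" unfolding E_def by (rule event_X) (use assms(1) in simp)
  have disj: "disjoint_family_on W F"
  proof (unfold disjoint_family_on_def, intro ballI impI)
    fix p q assume pq: "p \<in> F" "q \<in> F" "p \<noteq> q"
    then obtain m where "m \<in> {..k}" "p m \<noteq> q m"
      unfolding F_def by (blast intro: PiE_ext)
    then show "W p \<inter> W q = {}" by (auto simp: W_def)
  qed
  have eq: "{\<omega> \<in> space M. G (\<lambda>m. X (real m * \<delta>) \<omega>) \<and> X (real k * \<delta>) \<omega> = x} = (\<Union>p\<in>F. W p)"
  proof (intro set_eqI iffI)
    fix \<omega> assume \<omega>: "\<omega> \<in> {\<omega> \<in> space M. G (\<lambda>m. X (real m * \<delta>) \<omega>) \<and> X (real k * \<delta>) \<omega> = x}"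
    let ?p = "restrict (\<lambda>m. X (real m * \<delta>) \<omega>) {..k}"
    have "G ?p = G (\<lambda>m. X (real m * \<delta>) \<omega>)" by (rule G) simp
    then have "?p \<in> F" using \<omega> by (simp add: F_def)
    moreover have "\<omega> \<in> W ?p" using \<omega> by (simp add: W_def)
    ultimately show "\<omega> \<in> (\<Union>p\<in>F. W p)" by blast
  next
    fix \<omega> assume "\<omega> \<in> (\<Union>p\<in>F. W p)"
    then obtain p where p: "p \<in> F" "\<omega> \<in> W p" by blast
    then have "G (\<lambda>m. X (real m * \<delta>) \<omega>) = G p" by (intro G) (simp add: W_def)
    then show "\<omega> \<in> {\<omega> \<in> space M. G (\<lambda>m. X (real m * \<delta>) \<omega>) \<and> X (real k * \<delta>) \<omega> = x}"
      using p by (simp add: W_def F_def)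
  qed
  have step: "prob (W p \<inter> E) = prob (W p) * P \<delta> $ x $ y" if "p \<in> F" for p
  proof -
    have "real (Suc k) * \<delta> - real k * \<delta> = \<delta>" by (simp add: algebra_simps)
    moreover have "p k = x" using that by (simp add: F_def)
    moreover have "W p \<inter> E = {\<omega> \<in> space M. (\<forall>m\<le>k. X (real m * \<delta>) \<omega> = p m) \<and> X (real (Suc k) * \<delta>) \<omega> = y}"
      by (auto simp: W_def E_def)
    ultimately show ?thesis
      using prob_path_Suc[of "\<lambda>m. real m * \<delta>" k p y] assms(1) by (simp add: W_def)
  qed
  have "{\<omega> \<in> space M. (G (\<lambda>m. X (real m * \<delta>) \<omega>) \<and> X (real k * \<delta>) \<omega> = x) \<and> X (real (Suc k) * \<delta>) \<omega> = y}
    = {\<omega> \<in> space M. G (\<lambda>m. X (real m * \<delta>) \<omega>) \<and> X (real k * \<delta>) \<omega> = x} \<inter> E"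
    by (auto simp: E_def)
  also have "\<dots> = (\<Union>p\<in>F. W p \<inter> E)" by (simp add: eq)
  also have "prob \<dots> = (\<Sum>p\<in>F. prob (W p \<inter> E))"
    by (intro finite_measure_finite_Union fin)
      (use W E disj in \<open>auto simp: disjoint_family_on_def\<close>)
  also have "\<dots> = (\<Sum>p\<in>F. prob (W p)) * P \<delta> $ x $ y"
    by (simp add: step sum_distrib_right)
  also have "(\<Sum>p\<in>F. prob (W p)) = prob (\<Union>p\<in>F. W p)"
    by (intro finite_measure_finite_Union[symmetric] fin disj) (use W in auto)
  finally show ?thesis by (simp add: eq)
qed

section \<open>Conditional laws given the initial state\<close>

lemma measure_started_at:
  assumes "A \<in> events"
  shows "measure (started_at M X i) A = \<P>(\<omega> in M. X 0 \<omega> = i \<and> \<omega> \<in> A) / \<P>(\<omega> in M. X 0 \<omega> = i)"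
proof -
  have "measure (started_at M X i) A
      = prob ({\<omega> \<in> space M. X 0 \<omega> = i} \<inter> A) / prob {\<omega> \<in> space M. X 0 \<omega> = i}"
    unfolding started_at_def using initial_pos[of i] assms
    by (intro measure_uniform_measure) (auto simp: emeasure_eq_measure)
  moreover have "{\<omega> \<in> space M. X 0 \<omega> = i} \<inter> A = {\<omega> \<in> space M. X 0 \<omega> = i \<and> \<omega> \<in> A}"
    by auto
  ultimately show ?thesis by simp
qed

lemma sets_started_at [simp, measurable_cong]: "sets (started_at M X i) = sets M"
  and space_started_at [simp]: "space (started_at M X i) = space M"
  by (simp_all add: started_at_def)

lemma prob_space_started_at: "prob_space (started_at M X i)"
  unfolding started_at_def using initial_pos[of i]
  by (intro prob_space_uniform_measure) (auto simp: emeasure_eq_measure)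

lemma measure_started_at_state:
  assumes "0 \<le> t"
  shows "measure (started_at M X i) {\<omega> \<in> space M. X t \<omega> = j} = P t $ i $ j"
\<comment> \<open>Time 0 is separate because observation times in \<open>markov\<close> are strictly
  increasing.\<close>
proof (cases "t = 0")
  case True
  have "{\<omega> \<in> space M. X 0 \<omega> = i \<and> \<omega> \<in> space M \<and> X 0 \<omega> = j} =
    (if i = j then {\<omega> \<in> space M. X 0 \<omega> = i} else {})" by auto
  then show ?thesis
    using True initial_pos[of i] event_X[of 0 j] by (auto simp: measure_started_at at_zero mat_def)
next
  case False
  with assms have t: "0 < t" by simp
  have "{\<omega> \<in> space M. X 0 \<omega> = i \<and> \<omega> \<in> {\<omega> \<in> space M. X t \<omega> = j}}
    = {\<omega> \<in> space M. (\<forall>m\<le>0. X (real m * t) \<omega> = i) \<and> X (real (Suc 0) * t) \<omega> = j}" by auto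
  then show ?thesis
    using prob_path_Suc[of "\<lambda>m. real m * t" 0 "\<lambda>_. i" j] t initial_pos[of i] event_X[of t j]
    by (simp add: measure_started_at)
qed

end

section \<open>Expected occupation times\<close>

text \<open>Adding 1 to the floor puts the grid point strictly to the right of u even when u is
  itself dyadic, so that right-continuity at u applies along these points.\<close>

lemma dyadic_approx_gt: "u < (real_of_int \<lfloor>u * 2 ^ n\<rfloor> + 1) / 2 ^ n"
  by (simp add: pos_less_divide_eq)

lemma dyadic_approx_le: "(real_of_int \<lfloor>u * 2 ^ n\<rfloor> + 1) / 2 ^ n \<le> u + 1 / 2 ^ n"
  by (simp add: add_divide_distrib pos_divide_le_eq)

lemma filterlim_dyadic_approx:
  "filterlim (\<lambda>n. (real_of_int \<lfloor>u * 2 ^ n\<rfloor> + 1) / 2 ^ n) (at_right u) sequentially"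
proof -
  have "(\<lambda>n. u + 1 / 2 ^ n) \<longlonglongrightarrow> u + 0"
    by (intro tendsto_add tendsto_const LIMSEQ_divide_realpow_zero) simp
  then have "(\<lambda>n. u + 1 / 2 ^ n) \<longlonglongrightarrow> u" by simp
  then have "(\<lambda>n. (real_of_int \<lfloor>u * 2 ^ n\<rfloor> + 1) / 2 ^ n) \<longlonglongrightarrow> u"
    by (rule tendsto_sandwich[OF always_eventually always_eventually tendsto_const, rotated 2])
      (intro allI less_imp_le[OF dyadic_approx_gt] dyadic_approx_le)+
  moreover have "\<forall>\<^sub>F n in sequentially. (real_of_int \<lfloor>u * 2 ^ n\<rfloor> + 1) / 2 ^ n \<in> {u<..}"
    using dyadic_approx_gt[of u] by (intro always_eventually allI) (simp only: greaterThan_iff)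
  ultimately show ?thesis
    by (rule tendsto_imp_filterlim_at_right[OF _ eventually_mono]) simp
qed

context markov_chain
begin

text \<open>Joint measurability in path and time, needed for Fubini: sampling at the next dyadic
  point involves only countably many variables, and right-continuity makes the samples converge
  pointwise.\<close>

lemma measurable_state_event:
  "{(\<omega>, u) \<in> space M \<times> {0..t}. X u \<omega> = j} \<in> sets (M \<Otimes>\<^sub>M (lborel :: real measure))"
proof -
  define g :: "nat \<Rightarrow> 'w \<times> real \<Rightarrow> real" where
    \<comment> \<open>\<open>max 0\<close> keeps the sampling time in the range where
      \<open>X\<close> is known to be measurable; the second indicator discards negative times
      anyway.\<close>
    "g n z = indicator {j} (X (max 0 ((real_of_int \<lfloor>snd z * 2 ^ n\<rfloor> + 1) / 2 ^ n)) (fst z))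
       * indicator {0..t} (snd z)" for n z
  define h :: "'w \<times> real \<Rightarrow> real" where
    "h z = indicator {j} (X (snd z) (fst z)) * indicator {0..t} (snd z)" for z
  have "g n \<in> borel_measurable (M \<Otimes>\<^sub>M (lborel :: real measure))" for n
  proof -
    have "(\<lambda>z. X (max 0 ((real_of_int k + 1) / 2 ^ n)) (fst z))
        \<in> measurable (M \<Otimes>\<^sub>M (lborel :: real measure)) (count_space UNIV)" for k
      by (rule measurable_compose[OF measurable_fst measurable_X]) simp
    then have "(\<lambda>z. X (max 0 ((real_of_int \<lfloor>snd z * 2 ^ n\<rfloor> + 1) / 2 ^ n)) (fst z))
        \<in> measurable (M \<Otimes>\<^sub>M (lborel :: real measure)) (count_space UNIV)"
    proof (rule measurable_compose_countable)
      show "(\<lambda>z. \<lfloor>snd z * 2 ^ n\<rfloor>) \<in> measurable (M \<Otimes>\<^sub>M (lborel :: real measure)) (count_space UNIV)"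
        by (rule measurable_compose[OF _ measurable_real_floor]) simp
    qed
    then have "(\<lambda>z. indicator {j} (X (max 0 ((real_of_int \<lfloor>snd z * 2 ^ n\<rfloor> + 1) / 2 ^ n)) (fst z)) :: real)
        \<in> borel_measurable (M \<Otimes>\<^sub>M (lborel :: real measure))"
      by (rule measurable_compose) simp
    moreover have "(\<lambda>z. indicator {0..t} (snd z) :: real) \<in> borel_measurable (M \<Otimes>\<^sub>M (lborel :: real measure))"
      by (rule measurable_compose[OF measurable_snd]) simp
    ultimately show ?thesis unfolding g_def by (rule borel_measurable_times)
  qed
  moreover have "(\<lambda>n. g n z) \<longlonglongrightarrow> h z" if "z \<in> space (M \<Otimes>\<^sub>M (lborel :: real measure))" for z
  proof (cases "snd z \<in> {0..t}")
    case True
    obtain \<omega> u where z: "z = (\<omega>, u)" by fastforce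
    with True that have u: "0 \<le> u" "\<omega> \<in> space M" by (auto simp: space_pair_measure)
    from eventually_compose_filterlim[OF right_continuous[OF u(2,1)] filterlim_dyadic_approx]
    have "\<forall>\<^sub>F n in sequentially. g n z = h z"
    proof eventually_elim
      case (elim n)
      moreover have "0 \<le> (real_of_int \<lfloor>u * 2 ^ n\<rfloor> + 1) / 2 ^ n"
        using u dyadic_approx_gt[of u n] by linarith
      ultimately show ?case by (simp add: g_def h_def z max_absorb2)
    qed
    then show ?thesis by (rule tendsto_eventually)
  qed (simp add: g_def h_def)
  ultimately have "h \<in> borel_measurable (M \<Otimes>\<^sub>M (lborel :: real measure))"
    by (rule borel_measurable_LIMSEQ_metric)
  from measurable_sets[OF this, of "{1}"] 
  have "h -` {1} \<inter> space (M \<Otimes>\<^sub>M (lborel :: real measure)) \<in> sets (M \<Otimes>\<^sub>M (lborel :: real measure))" by simp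
  moreover have "h -` {1} \<inter> space (M \<Otimes>\<^sub>M (lborel :: real measure)) = {(\<omega>, u) \<in> space M \<times> {0..t}. X u \<omega> = j}"
    by (auto simp: h_def space_pair_measure split: split_indicator split_indicator_asm)
  ultimately show ?thesis by simp
qed

text \<open>Fubini for the indicator of the visits to j in [0, t], which is integrable because the
  whole strip has product measure t.\<close>

lemma expectation_occupation_time:
  assumes "0 \<le> t"
  shows "(\<integral>\<omega>. occupation_time X j t \<omega> \<partial>(started_at M X i)) = (LBINT u:{0..t}. P u $ i $ j)"
proof -
  interpret N: prob_space "started_at M X i" by (rule prob_space_started_at)
  interpret pair: pair_sigma_finite "started_at M X i" lborel by standard
  define A where "A = {(\<omega>, u) \<in> space M \<times> {0..t}. X u \<omega> = j}"
  have sets_eq: "sets (started_at M X i \<Otimes>\<^sub>M lborel) = sets (M \<Otimes>\<^sub>M (lborel :: real measure))"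
    by (intro sets_pair_measure_cong) simp_all
  have A: "A \<in> sets (started_at M X i \<Otimes>\<^sub>M lborel)"
    unfolding sets_eq A_def by (rule measurable_state_event)
  have "emeasure (started_at M X i \<Otimes>\<^sub>M lborel) A
      \<le> emeasure (started_at M X i \<Otimes>\<^sub>M lborel) (space M \<times> {0..t})"
  proof (rule emeasure_mono)
    show "A \<subseteq> space M \<times> {0..t}" unfolding A_def by blast
    show "space M \<times> {0..t} \<in> sets (started_at M X i \<Otimes>\<^sub>M lborel)"
      unfolding sets_eq by (intro pair_measureI) simp_all
  qed
  also have "\<dots> = emeasure (started_at M X i) (space M) * emeasure lborel {0..t}"
    by (rule lborel.emeasure_pair_measure_Times) simp_all
  also have "\<dots> = ennreal t"
    using N.emeasure_space_1 emeasure_lborel_Icc[OF assms] by simp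
  also have "\<dots> < \<infinity>" by simp
  finally have int: "integrable (started_at M X i \<Otimes>\<^sub>M lborel) (indicat_real A)"
    unfolding integrable_indicator_iff using A by (simp only: sets.Int_space_eq2)
  have "occupation_time X j t \<omega> = (\<integral>u. indicat_real A (\<omega>, u) \<partial>lborel)" if "\<omega> \<in> space M" for \<omega>
    unfolding occupation_time_def set_lebesgue_integral_def
    by (intro Bochner_Integration.integral_cong) (auto simp: A_def indicator_def that)
  then have "(\<integral>\<omega>. occupation_time X j t \<omega> \<partial>(started_at M X i))
      = (\<integral>\<omega>. (\<integral>u. indicat_real A (\<omega>, u) \<partial>lborel) \<partial>(started_at M X i))"
    by (intro Bochner_Integration.integral_cong) simp_all
  also have "\<dots> = (\<integral>u. (\<integral>\<omega>. indicat_real A (\<omega>, u) \<partial>(started_at M X i)) \<partial>lborel)"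
    using int by (intro pair.Fubini_integral[symmetric]) (simp add: case_prod_unfold)
  also have "\<dots> = (LBINT u:{0..t}. P u $ i $ j)"
    unfolding set_lebesgue_integral_def
  proof (intro Bochner_Integration.integral_cong refl)
    fix u
    have "(\<integral>\<omega>. indicat_real A (\<omega>, u) \<partial>(started_at M X i))
      = (\<integral>\<omega>. indicat_real {0..t} u * indicat_real {\<omega> \<in> space M. X u \<omega> = j} \<omega> \<partial>(started_at M X i))"
      by (intro Bochner_Integration.integral_cong) (auto simp: A_def indicator_def)
    also have "\<dots> = indicat_real {0..t} u * (\<integral>\<omega>. indicat_real {\<omega> \<in> space M. X u \<omega> = j} \<omega> \<partial>(started_at M X i))"
      by (rule integral_mult_right_zero)
    also have "(\<integral>\<omega>. indicat_real {\<omega> \<in> space M. X u \<omega> = j} \<omega> \<partial>(started_at M X i))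
        = measure (started_at M X i) {\<omega> \<in> space M. X u \<omega> = j}"
      unfolding Bochner_Integration.integral_indicator space_started_at
      by (rule arg_cong[where f="measure _"]) blast
    also have "indicat_real {0..t} u * \<dots> = indicat_real {0..t} u *\<^sub>R P u $ i $ j"
      unfolding real_scaleR_def using measure_started_at_state[of u i j] by (simp split: split_indicator)
    finally show "(\<integral>\<omega>. indicat_real A (\<omega>, u) \<partial>(started_at M X i)) = indicat_real {0..t} u *\<^sub>R P u $ i $ j" .
  qed
  finally show ?thesis .
qed

end

section \<open>Hitting times on dyadic skeletons\<close>

text \<open>This is \<delta> times the first grid index at which j is seen, and \<open>top\<close>
  if there is none. As a series of survival indicators it integrates term by term into avoidance
  probabilities.\<close>

definition skeleton_time :: "(real \<Rightarrow> 'w \<Rightarrow> 's) \<Rightarrow> 's \<Rightarrow> real \<Rightarrow> 'w \<Rightarrow> ennreal" where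
  "skeleton_time X j \<delta> \<omega> = (\<Sum>k. ennreal (\<delta> * of_bool (\<forall>m\<le>k. X (real m * \<delta>) \<omega> \<noteq> j)))"

lemma skeleton_time_le:
  assumes "0 \<le> \<delta>" "X (real k * \<delta>) \<omega> = j"
  shows "skeleton_time X j \<delta> \<omega> \<le> ennreal (real k * \<delta>)"
proof -
  have "skeleton_time X j \<delta> \<omega> = (\<Sum>l<k. ennreal (\<delta> * of_bool (\<forall>m\<le>l. X (real m * \<delta>) \<omega> \<noteq> j)))"
    unfolding skeleton_time_def by (rule suminf_finite) (use assms in \<open>auto simp: not_less\<close>)
  also have "\<dots> \<le> (\<Sum>l<k. ennreal \<delta>)"
    using assms(1) by (intro sum_mono ennreal_leI) (simp add: of_bool_def)
  also have "\<dots> = ennreal (real k * \<delta>)"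
    using assms(1) by (subst sum_ennreal) simp_all
  finally show ?thesis .
qed

lemma skeleton_time_ge:
  assumes "0 \<le> \<delta>" "\<And>m. m < k \<Longrightarrow> X (real m * \<delta>) \<omega> \<noteq> j"
  shows "ennreal (real k * \<delta>) \<le> skeleton_time X j \<delta> \<omega>"
proof -
  have "ennreal (real k * \<delta>) = (\<Sum>l<k. ennreal \<delta>)"
    using assms(1) by (subst sum_ennreal) simp_all
  also have "\<dots> = (\<Sum>l<k. ennreal (\<delta> * of_bool (\<forall>m\<le>l. X (real m * \<delta>) \<omega> \<noteq> j)))"
    using assms(2) by (intro sum.cong) auto
  also have "\<dots> \<le> skeleton_time X j \<delta> \<omega>"
    unfolding skeleton_time_def by (rule sum_le_suminf) auto
  finally show ?thesis .
qed

lemma skeleton_time_cases: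
  assumes "0 < \<delta>"
  obtains "skeleton_time X j \<delta> \<omega> = top"
  | k where "X (real k * \<delta>) \<omega> = j" "skeleton_time X j \<delta> \<omega> = ennreal (real k * \<delta>)"
proof (cases "\<exists>k. X (real k * \<delta>) \<omega> = j")
  case True
  define k where "k = (LEAST k. X (real k * \<delta>) \<omega> = j)"
  have k: "X (real k * \<delta>) \<omega> = j" unfolding k_def using True by (rule LeastI_ex)
  have "X (real m * \<delta>) \<omega> \<noteq> j" if "m < k" for m
    using not_less_Least[OF that[unfolded k_def]] .
  then have "skeleton_time X j \<delta> \<omega> = ennreal (real k * \<delta>)"
    using assms k by (intro antisym skeleton_time_le skeleton_time_ge) auto
  with k show thesis by (rule that(2))
next
  case False
  have "skeleton_time X j \<delta> \<omega> = top"
  proof (rule ccontr)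
    assume "skeleton_time X j \<delta> \<omega> \<noteq> top"
    then obtain r where r: "0 \<le> r" "skeleton_time X j \<delta> \<omega> = ennreal r"
      by (cases "skeleton_time X j \<delta> \<omega>") auto
    obtain k where "r / \<delta> < real k" using reals_Archimedean2 by blast
    then have k: "r < real k * \<delta>" using assms by (simp add: pos_divide_less_eq)
    have "ennreal (real k * \<delta>) \<le> ennreal r"
      using skeleton_time_ge[of \<delta> k X \<omega> j] False assms r by auto
    then show False using k r(1) by (simp add: ennreal_le_iff)
  qed
  then show thesis by (rule that(1))
qed

lemma hitting_time_le: "0 \<le> t \<Longrightarrow> X t \<omega> = j \<Longrightarrow> hitting_time X j \<omega> \<le> ennreal t"
  unfolding hitting_time_def by (rule INF_lower) simp

lemma hitting_time_le_skeleton_time: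
  assumes "0 < \<delta>" shows "hitting_time X j \<omega> \<le> skeleton_time X j \<delta> \<omega>"
  by (rule skeleton_time_cases[OF assms, of X j \<omega>]) (use assms in \<open>simp_all add: hitting_time_le\<close>)

text \<open>Dyadic grids are nested: index k at one level is index 2 k at the next, so a visit seen
  on the coarse grid is also seen on the finer one.\<close>

lemma decseq_skeleton_time: "decseq (\<lambda>n. skeleton_time X j (1 / 2 ^ n) \<omega>)"
proof (rule decseq_SucI)
  fix n
  show "skeleton_time X j (1 / 2 ^ Suc n) \<omega> \<le> skeleton_time X j (1 / 2 ^ n) \<omega>"
  proof (rule skeleton_time_cases[of "1 / 2 ^ n" X j \<omega>])
    fix k assume k: "X (real k * (1 / 2 ^ n)) \<omega> = j"
      "skeleton_time X j (1 / 2 ^ n) \<omega> = ennreal (real k * (1 / 2 ^ n))"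
    have eq: "real (2 * k) * (1 / 2 ^ Suc n) = real k * (1 / 2 ^ n)" by simp
    show ?thesis
      using skeleton_time_le[of "1 / 2 ^ Suc n" X "2 * k" \<omega> j] k unfolding eq by simp
  qed simp_all
qed

text \<open>Right-continuity makes every visit to \<open>j\<close> last for some positive time, hence visible on
  all sufficiently fine dyadic skeletons.\<close>

lemma (in markov_chain) hitting_time_eq_INF:
  assumes "\<omega> \<in> space M"
  shows "hitting_time X j \<omega> = (INF n. skeleton_time X j (1 / 2 ^ n) \<omega>)"
proof (rule antisym)
  show "hitting_time X j \<omega> \<le> (INF n. skeleton_time X j (1 / 2 ^ n) \<omega>)"
    by (intro INF_greatest hitting_time_le_skeleton_time) simp
  show "(INF n. skeleton_time X j (1 / 2 ^ n) \<omega>) \<le> hitting_time X j \<omega>"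
    unfolding hitting_time_def
  proof (rule INF_greatest)
    fix t assume "t \<in> {t. 0 \<le> t \<and> X t \<omega> = j}"
    then have t: "0 \<le> t" "X t \<omega> = j" by auto
    show "(INF n. skeleton_time X j (1 / 2 ^ n) \<omega>) \<le> ennreal t"
    proof (rule ennreal_le_epsilon)
      fix e :: real assume e: "0 < e"
      define u where "u n = (real_of_int \<lfloor>t * 2 ^ n\<rfloor> + 1) / 2 ^ n" for n
      have "\<forall>\<^sub>F n in sequentially. X (u n) \<omega> = j"
        using eventually_compose_filterlim[OF right_continuous[OF assms t(1)] filterlim_dyadic_approx] t(2)
        by (simp add: u_def)
      moreover have "\<forall>\<^sub>F n in sequentially. 1 / 2 ^ n < e"
        by (rule order_tendstoD(2)[OF LIMSEQ_divide_realpow_zero e]) simp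
      ultimately have "\<exists>n. X (u n) \<omega> = j \<and> 1 / 2 ^ n < e"
        by (intro eventually_happens'[OF sequentially_bot eventually_conj])
      then obtain n where n: "X (u n) \<omega> = j" "1 / 2 ^ n < e"
        by blast
      define k where "k = nat (\<lfloor>t * 2 ^ n\<rfloor> + 1)"
      have "0 \<le> \<lfloor>t * 2 ^ n\<rfloor>" using t by simp
      then have k: "real k * (1 / 2 ^ n) = u n" by (simp add: k_def u_def)
      have "(INF n. skeleton_time X j (1 / 2 ^ n) \<omega>) \<le> skeleton_time X j (1 / 2 ^ n) \<omega>"
        by (rule INF_lower) simp
      also have "\<dots> \<le> ennreal (real k * (1 / 2 ^ n))"
        using n(1) unfolding k[symmetric] by (intro skeleton_time_le) simp
      also have "\<dots> \<le> ennreal (t + e)"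
        unfolding k using dyadic_approx_le[of t n] n(2) by (intro ennreal_leI) (simp add: u_def)
      also have "\<dots> = ennreal t + ennreal e" using t e by simp
      finally show "(INF n. skeleton_time X j (1 / 2 ^ n) \<omega>) \<le> ennreal t + ennreal e" .
    qed
  qed
qed

text \<open>The analytic core, with \<open>e k\<close> the mass surviving k steps and
  \<open>S k\<close> the integral of v over it. The lower step bound forces \<open>e\<close> to be
  summable, hence to tend to 0; then \<open>S\<close> tends to 0 by domination, and the drops sum to
  exactly \<open>S 0\<close>. This replaces optional stopping.\<close>

lemma telescoping_bounds:
  fixes e S :: "nat \<Rightarrow> real"
  assumes e: "\<And>k. 0 \<le> e k" "\<And>k. e k \<le> 1" and S: "\<And>k. \<bar>S k\<bar> \<le> V * e k"
    and step: "\<And>k. lo * e k \<le> S k - S (Suc k)" "\<And>k. S k - S (Suc k) \<le> hi * e k"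
    and "0 < lo" "0 \<le> V"
  shows "summable e" "lo * suminf e \<le> S 0" "S 0 \<le> hi * suminf e"
proof -
  have tele: "(\<Sum>k<n. S k - S (Suc k)) = S 0 - S n" for n
    by (rule sum_lessThan_telescope')
  have "(\<Sum>k<n. e k) \<le> (S 0 + V) / lo" for n
  proof -
    have "lo * (\<Sum>k<n. e k) \<le> S 0 - S n"
      unfolding sum_distrib_left tele[symmetric] by (rule sum_mono) (rule step)
    also have "\<dots> \<le> S 0 + V"
      using S[of n] mult_left_mono[OF e(2)[of n] \<open>0 \<le> V\<close>] by (simp add: abs_le_iff)
    finally show ?thesis using \<open>0 < lo\<close> by (simp add: pos_le_divide_eq mult.commute)
  qed
  then show sum: "summable e" by (rule summableI_nonneg_bounded[OF e(1)])
  have "(\<lambda>k. V * e k) \<longlonglongrightarrow> V * 0"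
    by (intro tendsto_mult tendsto_const summable_LIMSEQ_zero sum)
  then have lim: "(\<lambda>k. V * e k) \<longlonglongrightarrow> 0" by simp
  have "\<forall>\<^sub>F k in sequentially. norm (S k) \<le> V * e k"
    unfolding real_norm_def by (intro always_eventually allI S)
  then have "S \<longlonglongrightarrow> 0" using lim by (rule Lim_null_comparison)
  then have "(\<lambda>k. S k - S (Suc k)) sums (S 0 - 0)"
    by (rule telescope_sums')
  then have S0: "(\<lambda>k. S k - S (Suc k)) sums S 0" by simp
  show "lo * suminf e \<le> S 0"
    by (rule sums_le[OF step(1) sums_mult[OF summable_sums[OF sum]] S0])
  show "S 0 \<le> hi * suminf e"
    by (rule sums_le[OF step(2) S0 sums_mult[OF summable_sums[OF sum]]])
qed

section \<open>Expected hitting times\<close>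

lemma disjoint_family_fibresI: "(\<And>x \<omega>. \<omega> \<in> W x \<Longrightarrow> f \<omega> = x) \<Longrightarrow> disjoint_family W"
  unfolding disjoint_family_on_def by blast

lemma Collect_eq_UN_fibres: "{\<omega> \<in> S. A \<omega>} = (\<Union>x\<in>UNIV. {\<omega> \<in> S. A \<omega> \<and> f \<omega> = x})"
  by blast

context markov_chain
begin

lemma event_avoid:
  assumes "0 < \<delta>"
  shows "{\<omega> \<in> space M. \<forall>m\<le>k. X (real m * \<delta>) \<omega> \<noteq> j} \<in> events"
proof -
  have "{\<omega> \<in> space M. \<forall>m\<in>{..k}. X (real m * \<delta>) \<omega> \<noteq> j} \<in> events"
  proof (rule sets.sets_Collect_finite_All)
    fix m :: nat
    show "{\<omega> \<in> space M. X (real m * \<delta>) \<omega> \<noteq> j} \<in> events"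
      by (rule sets.sets_Collect_neg, rule event_X) (use assms in simp)
  qed (rule finite_atMost)
  then show ?thesis unfolding Ball_def atMost_iff .
qed

text \<open>The sub-probability law after k steps of the skeleton killed at j. It is kept
  unnormalised, with X(0) = i as part of the event, to match the product form of the Markov
  property.\<close>

definition avoid_prob :: "'s \<Rightarrow> 's \<Rightarrow> real \<Rightarrow> nat \<Rightarrow> 's \<Rightarrow> real" where
  "avoid_prob i j \<delta> k y =
     \<P>(\<omega> in M. (X 0 \<omega> = i \<and> (\<forall>m\<le>k. X (real m * \<delta>) \<omega> \<noteq> j)) \<and> X (real k * \<delta>) \<omega> = y)"

lemma event_start_avoid:
  assumes "0 < \<delta>"
  shows "{\<omega> \<in> space M. X 0 \<omega> = i \<and> (\<forall>m\<le>k. X (real m * \<delta>) \<omega> \<noteq> j)} \<in> events"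
  by (intro sets.sets_Collect_conj event_X event_avoid assms order_refl)

text \<open>One step of the killed chain. As y differs from j, ending in y already guarantees
  survival of the last step.\<close>

lemma avoid_prob_Suc:
  assumes "0 < \<delta>" "y \<noteq> j"
  shows "avoid_prob i j \<delta> (Suc k) y = (\<Sum>x\<in>UNIV. avoid_prob i j \<delta> k x * P \<delta> $ x $ y)"
proof -
  define W where "W x = {\<omega> \<in> space M. ((X 0 \<omega> = i \<and> (\<forall>m\<le>k. X (real m * \<delta>) \<omega> \<noteq> j))
    \<and> X (real k * \<delta>) \<omega> = x) \<and> X (real (Suc k) * \<delta>) \<omega> = y}" for x
  have W: "W x \<in> events" for x
    unfolding W_def
    by (rule sets.sets_Collect_conj[OF event_X sets.sets_Collect_conj[OF event_X event_start_avoid[OF assms(1)]]])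
      (use assms(1) in simp_all)
  have prob: "prob (W x) = avoid_prob i j \<delta> k x * P \<delta> $ x $ y" for x
  proof -
    define G where "G f \<longleftrightarrow> f 0 = i \<and> (\<forall>m\<le>k. f m \<noteq> j)" for f :: "nat \<Rightarrow> 's"
    have cong: "G f = G g" if "\<And>m. m \<le> k \<Longrightarrow> f m = g m" for f g
      using that by (simp add: G_def)
    from prob_skeleton_Suc[where G=G and k=k and x=x and y=y, OF assms(1) cong]
    show ?thesis unfolding W_def avoid_prob_def G_def of_nat_0 mult_zero_left .
  qed
  have "(\<forall>m\<le>Suc k. R m) \<longleftrightarrow> (\<forall>m\<le>k. R m) \<and> R (Suc k)" for R :: "nat \<Rightarrow> bool"
    by (auto simp: le_Suc_eq)
  then have split: "(\<forall>m\<le>Suc k. X (real m * \<delta>) \<omega> \<noteq> j) \<longleftrightarrow>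
    (\<forall>m\<le>k. X (real m * \<delta>) \<omega> \<noteq> j) \<and> X (real (Suc k) * \<delta>) \<omega> \<noteq> j" for \<omega>
    by this
  have "{\<omega> \<in> space M. (X 0 \<omega> = i \<and> (\<forall>m\<le>Suc k. X (real m * \<delta>) \<omega> \<noteq> j))
      \<and> X (real (Suc k) * \<delta>) \<omega> = y} = (\<Union>x\<in>UNIV. W x)"
  proof (rule set_eqI)
    fix \<omega>
    define A where "A \<longleftrightarrow> (\<forall>m\<le>k. X (real m * \<delta>) \<omega> \<noteq> j)"
    show "\<omega> \<in> {\<omega> \<in> space M. (X 0 \<omega> = i \<and> (\<forall>m\<le>Suc k. X (real m * \<delta>) \<omega> \<noteq> j))
      \<and> X (real (Suc k) * \<delta>) \<omega> = y} \<longleftrightarrow> \<omega> \<in> (\<Union>x\<in>UNIV. W x)"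
      unfolding W_def UN_iff mem_Collect_eq split A_def[symmetric] using assms(2) by auto
  qed
  then have "avoid_prob i j \<delta> (Suc k) y = prob (\<Union>x\<in>UNIV. W x)"
    unfolding avoid_prob_def by (rule arg_cong)
  also have "\<dots> = (\<Sum>x\<in>UNIV. prob (W x))"
  proof (rule finite_measure_finite_Union)
    show "W ` UNIV \<subseteq> events" using W by blast
    show "disjoint_family W"
      by (rule disjoint_family_fibresI[of W "X (real k * \<delta>)"]) (unfold W_def, elim CollectE conjE)
  qed (rule finite)
  finally show ?thesis by (simp add: prob)
qed

lemma sum_avoid_prob:
  assumes "0 < \<delta>"
  shows "\<P>(\<omega> in M. X 0 \<omega> = i \<and> (\<forall>m\<le>k. X (real m * \<delta>) \<omega> \<noteq> j)) = (\<Sum>x\<in>UNIV. avoid_prob i j \<delta> k x)"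
proof -
  define W where "W x = {\<omega> \<in> space M. (X 0 \<omega> = i \<and> (\<forall>m\<le>k. X (real m * \<delta>) \<omega> \<noteq> j))
    \<and> X (real k * \<delta>) \<omega> = x}" for x
  have W: "W x \<in> events" for x
    unfolding W_def
    by (rule sets.sets_Collect_conj[OF event_X event_start_avoid[OF assms]]) (use assms in simp)
  have "{\<omega> \<in> space M. X 0 \<omega> = i \<and> (\<forall>m\<le>k. X (real m * \<delta>) \<omega> \<noteq> j)} = (\<Union>x\<in>UNIV. W x)"
    unfolding W_def by (rule Collect_eq_UN_fibres)
  then have "\<P>(\<omega> in M. X 0 \<omega> = i \<and> (\<forall>m\<le>k. X (real m * \<delta>) \<omega> \<noteq> j)) = prob (\<Union>x\<in>UNIV. W x)"
    by (rule arg_cong)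
  also have "\<dots> = (\<Sum>x\<in>UNIV. prob (W x))"
  proof (rule finite_measure_finite_Union)
    show "W ` UNIV \<subseteq> events" using W by blast
    show "disjoint_family W"
      by (rule disjoint_family_fibresI[of W "X (real k * \<delta>)"]) (unfold W_def, elim CollectE conjE)
  qed (rule finite)
  finally show ?thesis by (simp add: W_def avoid_prob_def)
qed

lemma avoid_prob_target: "avoid_prob i j \<delta> k j = 0"
proof -
  have "{\<omega> \<in> space M. (X 0 \<omega> = i \<and> (\<forall>m\<le>k. X (real m * \<delta>) \<omega> \<noteq> j)) \<and> X (real k * \<delta>) \<omega> = j} = {}"
    by blast
  then show ?thesis unfolding avoid_prob_def by (simp only: measure_empty)
qed

lemma avoid_prob_0:
  "avoid_prob i j \<delta> 0 y = (if y = i \<and> i \<noteq> j then \<P>(\<omega> in M. X 0 \<omega> = i) else 0)"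
proof -
  have "{\<omega> \<in> space M. (X 0 \<omega> = i \<and> (\<forall>m\<le>0. X (real m * \<delta>) \<omega> \<noteq> j)) \<and> X (real 0 * \<delta>) \<omega> = y}
    = (if y = i \<and> i \<noteq> j then {\<omega> \<in> space M. X 0 \<omega> = i} else {})"
    by (cases "y = i \<and> i \<noteq> j") auto
  then show ?thesis
    unfolding avoid_prob_def by (simp only: if_distrib[of prob] measure_empty)
qed

text \<open>The discrete-time supermartingale argument: on the skeleton, \<open>v\<close> decreases in mean by
  roughly \<open>c * \<delta>\<close> per step until \<open>j\<close> is hit, so \<open>v $ i\<close> is roughly \<open>c\<close> times the
  mean time spent before hitting \<open>j\<close>.\<close>

lemma skeleton_bounds:
  fixes i j :: 's and v :: "real^'s"
  assumes \<delta>: "0 < \<delta>" and v: "v $ j = 0" and lo: "0 < lo"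
    and drift: "\<And>x. x \<noteq> j \<Longrightarrow> lo * \<delta> \<le> v $ x - (P \<delta> *v v) $ x"
      "\<And>x. x \<noteq> j \<Longrightarrow> v $ x - (P \<delta> *v v) $ x \<le> hi * \<delta>"
  defines "c \<equiv> \<lambda>k. measure (started_at M X i) {\<omega> \<in> space M. \<forall>m\<le>k. X (real m * \<delta>) \<omega> \<noteq> j}"
  shows "summable c" "lo * (\<delta> * suminf c) \<le> v $ i" "v $ i \<le> hi * (\<delta> * suminf c)"
proof -
  define q where "q = \<P>(\<omega> in M. X 0 \<omega> = i)"
  have q: "0 < q" unfolding q_def by (rule initial_pos)
  define e where "e k = \<P>(\<omega> in M. X 0 \<omega> = i \<and> (\<forall>m\<le>k. X (real m * \<delta>) \<omega> \<noteq> j))" for k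
  define a where "a = avoid_prob i j \<delta>"
  define S where "S k = (\<Sum>y\<in>UNIV. a k y * v $ y)" for k
  have a_nonneg: "0 \<le> a k y" for k y by (simp add: a_def avoid_prob_def)
  have e_eq: "e k = (\<Sum>x\<in>UNIV. a k x)" for k
    unfolding e_def a_def by (rule sum_avoid_prob[OF \<delta>])
  have a_le: "a k y \<le> e k" for k y
    unfolding e_eq by (rule member_le_sum) (simp_all add: a_nonneg)
  have c_eq: "e k = q * c k" for k
  proof -
    have "{\<omega> \<in> space M. X 0 \<omega> = i \<and> \<omega> \<in> {\<omega> \<in> space M. \<forall>m\<le>k. X (real m * \<delta>) \<omega> \<noteq> j}}
      = {\<omega> \<in> space M. X 0 \<omega> = i \<and> (\<forall>m\<le>k. X (real m * \<delta>) \<omega> \<noteq> j)}" by blast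
    then have "c k = e k / q"
      unfolding c_def e_def q_def measure_started_at[OF event_avoid[OF \<delta>]] by (simp only:)
    then show ?thesis using q by simp
  qed
  have S_diff: "S k - S (Suc k) = (\<Sum>x\<in>UNIV. a k x * (v $ x - (P \<delta> *v v) $ x))" for k
  proof -
    \<comment> \<open>\<open>avoid_prob_Suc\<close> excludes y = j, but there both sides vanish
      because v is 0 at j.\<close>
    have "a (Suc k) y * v $ y = (\<Sum>x\<in>UNIV. a k x * P \<delta> $ x $ y) * v $ y" for y
      using v avoid_prob_Suc[OF \<delta>, of y j i k] by (cases "y = j") (simp_all add: a_def)
    then have "S (Suc k) = (\<Sum>y\<in>UNIV. \<Sum>x\<in>UNIV. a k x * (P \<delta> $ x $ y * v $ y))"
      by (simp add: S_def sum_distrib_right mult.assoc)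
    also have "\<dots> = (\<Sum>x\<in>UNIV. a k x * (P \<delta> *v v) $ x)"
      by (subst sum.swap) (simp add: matrix_vector_mult_def sum_distrib_left)
    finally show ?thesis by (simp add: S_def right_diff_distrib sum_subtractf)
  qed
  \<comment> \<open>The drift at j is uncontrolled; it receives weight 0, since no surviving mass
    sits at j.\<close>
  have a_j: "a k j = 0" for k unfolding a_def by (rule avoid_prob_target)
  have step_lo: "lo * \<delta> * e k \<le> S k - S (Suc k)" for k
    unfolding S_diff e_eq sum_distrib_left
  proof (rule sum_mono)
    fix x show "lo * \<delta> * a k x \<le> a k x * (v $ x - (P \<delta> *v v) $ x)"
      using mult_left_mono[OF drift(1) a_nonneg, of x k] a_j[of k]
      by (cases "x = j") (simp_all add: mult.commute)
  qed
  have step_hi: "S k - S (Suc k) \<le> hi * \<delta> * e k" for k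
    unfolding S_diff e_eq sum_distrib_left
  proof (rule sum_mono)
    fix x show "a k x * (v $ x - (P \<delta> *v v) $ x) \<le> hi * \<delta> * a k x"
      using mult_left_mono[OF drift(2) a_nonneg, of x k] a_j[of k]
      by (cases "x = j") (simp_all add: mult.commute)
  qed
  define V where "V = (\<Sum>y\<in>UNIV. \<bar>v $ y\<bar>)"
  have S_bound: "\<bar>S k\<bar> \<le> V * e k" for k
  proof -
    have "\<bar>S k\<bar> \<le> (\<Sum>y\<in>UNIV. \<bar>a k y * v $ y\<bar>)" unfolding S_def by (rule sum_abs)
    also have "\<dots> \<le> (\<Sum>y\<in>UNIV. \<bar>v $ y\<bar> * e k)"
    proof (rule sum_mono)
      fix y show "\<bar>a k y * v $ y\<bar> \<le> \<bar>v $ y\<bar> * e k"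
        using mult_left_mono[OF a_le[of k y], of "\<bar>v $ y\<bar>"] a_nonneg[of k y]
        by (simp add: abs_mult mult.commute)
    qed
    finally show ?thesis by (simp add: V_def sum_distrib_right)
  qed
  have S0: "S 0 = q * v $ i"
  proof -
    have "S 0 = (\<Sum>y\<in>UNIV. if y = i then q * v $ i else 0)"
      unfolding S_def a_def avoid_prob_0 q_def[symmetric] by (rule sum.cong) (auto simp: v)
    then show ?thesis by simp
  qed
  have "0 < lo * \<delta>" "0 \<le> V" using lo \<delta> by (simp_all add: V_def sum_nonneg)
  moreover have "0 \<le> e k" "e k \<le> 1" for k unfolding e_def by (rule measure_nonneg, rule prob_le_1)
  ultimately have *: "summable e" "lo * \<delta> * suminf e \<le> S 0" "S 0 \<le> hi * \<delta> * suminf e"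
    using telescoping_bounds[of e S V "lo * \<delta>" "hi * \<delta>"] S_bound step_lo step_hi by blast+
  have "summable (\<lambda>k. e k / q)" by (rule summable_divide) (rule *(1))
  then show sum: "summable c" using q by (simp add: c_eq)
  have "suminf e = q * suminf c" unfolding c_eq by (rule suminf_mult) (rule sum)
  with *(2,3) S0 have "q * (lo * (\<delta> * suminf c)) \<le> q * v $ i" "q * v $ i \<le> q * (hi * (\<delta> * suminf c))"
    by (simp_all add: ac_simps)
  then show "lo * (\<delta> * suminf c) \<le> v $ i" "v $ i \<le> hi * (\<delta> * suminf c)"
    using q by simp_all
qed

lemma measurable_skeleton_time:
  assumes "0 < \<delta>"
  shows "skeleton_time X j \<delta> \<in> borel_measurable M"
proof -
  have "Measurable.pred M (\<lambda>\<omega>. \<forall>m\<le>k. X (real m * \<delta>) \<omega> \<noteq> j)" for k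
    unfolding pred_def by (rule event_avoid[OF assms])
  then show ?thesis
    unfolding skeleton_time_def[abs_def] by measurable
qed

text \<open>The tail-sum formula for the mean; summability lets the extended series be read as a
  real one.\<close>

lemma nn_integral_skeleton_time:
  fixes i j :: 's
  assumes "0 < \<delta>"
  defines "c \<equiv> \<lambda>k. measure (started_at M X i) {\<omega> \<in> space M. \<forall>m\<le>k. X (real m * \<delta>) \<omega> \<noteq> j}"
  assumes sum: "summable c"
  shows "(\<integral>\<^sup>+\<omega>. skeleton_time X j \<delta> \<omega> \<partial>(started_at M X i)) = ennreal (\<delta> * suminf c)"
proof -
  interpret N: prob_space "started_at M X i" by (rule prob_space_started_at)
  define A where "A k = {\<omega> \<in> space M. \<forall>m\<le>k. X (real m * \<delta>) \<omega> \<noteq> j}" for k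
  have A: "A k \<in> sets (started_at M X i)" for k
    unfolding A_def sets_started_at by (rule event_avoid[OF assms(1)])
  have "(\<integral>\<^sup>+\<omega>. skeleton_time X j \<delta> \<omega> \<partial>(started_at M X i))
      = (\<integral>\<^sup>+\<omega>. (\<Sum>k. ennreal \<delta> * indicator (A k) \<omega>) \<partial>(started_at M X i))"
  proof (rule nn_integral_cong)
    fix \<omega> assume "\<omega> \<in> space (started_at M X i)"
    then have iff: "(\<forall>m\<le>k. X (real m * \<delta>) \<omega> \<noteq> j) \<longleftrightarrow> \<omega> \<in> A k" for k
      by (simp add: A_def)
    have "ennreal (\<delta> * of_bool (\<forall>m\<le>k. X (real m * \<delta>) \<omega> \<noteq> j)) = ennreal \<delta> * indicator (A k) \<omega>" for k
      unfolding iff by (simp split: split_indicator)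
    then show "skeleton_time X j \<delta> \<omega> = (\<Sum>k. ennreal \<delta> * indicator (A k) \<omega>)"
      unfolding skeleton_time_def by (simp only:)
  qed
  also have "\<dots> = (\<Sum>k. \<integral>\<^sup>+\<omega>. ennreal \<delta> * indicator (A k) \<omega> \<partial>(started_at M X i))"
    using A by (intro nn_integral_suminf) simp
  also have "\<dots> = (\<Sum>k. ennreal (\<delta> * c k))"
  proof (rule suminf_cong)
    fix k
    have "(\<integral>\<^sup>+\<omega>. ennreal \<delta> * indicator (A k) \<omega> \<partial>(started_at M X i))
      = ennreal \<delta> * emeasure (started_at M X i) (A k)"
      by (rule nn_integral_cmult_indicator) (rule A)
    also have "\<dots> = ennreal (\<delta> * c k)"
      unfolding N.emeasure_eq_measure c_def A_def
      by (rule ennreal_mult[symmetric]) (use assms(1) in simp_all)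
    finally show "(\<integral>\<^sup>+\<omega>. ennreal \<delta> * indicator (A k) \<omega> \<partial>(started_at M X i)) = ennreal (\<delta> * c k)" .
  qed
  also have "\<dots> = ennreal (\<Sum>k. \<delta> * c k)"
  proof (rule suminf_ennreal2)
    show "0 \<le> \<delta> * c k" for k using assms(1) by (simp add: c_def)
    show "summable (\<lambda>k. \<delta> * c k)" using sum by (rule summable_mult)
  qed
  also have "(\<Sum>k. \<delta> * c k) = \<delta> * suminf c" by (rule suminf_mult) (rule sum)
  finally show ?thesis .
qed

text \<open>Here v solves the Dirichlet problem whose solution is c times the mean hitting time. The
  skeleton estimates hold with drift bounds c - \<eta> and c + \<eta> on all fine grids; n goes to
  infinity for fixed \<eta>, and then \<eta> to 0. Nonnegativity of v is a by-product that the
  caller needs for arithmetic in \<open>ennreal\<close>.\<close>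

lemma nn_integral_hitting_time:
  assumes v: "v $ j = 0" and c: "0 < c" and drift: "\<And>x. x \<noteq> j \<Longrightarrow> (Q *v v) $ x = - c"
  shows "(\<integral>\<^sup>+\<omega>. hitting_time X j \<omega> \<partial>(started_at M X i)) = ennreal (v $ i / c)" "0 \<le> v $ i"
proof -
  define T where "T n = (\<integral>\<^sup>+\<omega>. skeleton_time X j (1 / 2 ^ n) \<omega> \<partial>(started_at M X i))" for n
  define H where "H = (\<integral>\<^sup>+\<omega>. hitting_time X j \<omega> \<partial>(started_at M X i))"
  have T: "\<forall>\<^sub>F n in sequentially. \<exists>t\<ge>0. T n = ennreal t \<and> (c - \<eta>) * t \<le> v $ i \<and> v $ i \<le> (c + \<eta>) * t"
    if \<eta>: "0 < \<eta>" "\<eta> < c" for \<eta>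
  proof -
    have "\<forall>\<^sub>F h in at_right 0. x \<noteq> j \<longrightarrow>
        (c - \<eta>) * h \<le> v $ x - (P h *v v) $ x \<and> v $ x - (P h *v v) $ x \<le> (c + \<eta>) * h" for x
    proof (cases "x = j")
      case False
      have lim: "((\<lambda>h. ((P h *v v) $ x - v $ x) / h) \<longlongrightarrow> - c) (at_right 0)"
        using slope_vec[of v x] drift[OF False] by simp
      have "\<forall>\<^sub>F h in at_right 0. ((P h *v v) $ x - v $ x) / h < - (c - \<eta>)"
        by (rule order_tendstoD(2)[OF lim]) (use \<eta> in simp)
      moreover have "\<forall>\<^sub>F h in at_right 0. - (c + \<eta>) < ((P h *v v) $ x - v $ x) / h"
        by (rule order_tendstoD(1)[OF lim]) (use \<eta> in simp)
      moreover have "\<forall>\<^sub>F h in at_right (0::real). 0 < h"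
        by (rule eventually_at_right_less)
      ultimately show ?thesis
      proof eventually_elim
        case (elim h)
        have "(P h *v v) $ x - v $ x < - (c - \<eta>) * h" "- (c + \<eta>) * h < (P h *v v) $ x - v $ x"
          using elim(1,2) by (simp_all only: pos_divide_less_eq[OF elim(3)] pos_less_divide_eq[OF elim(3)])
        then show ?case by (simp add: left_diff_distrib distrib_right)
      qed
    qed simp
    \<comment> \<open>Finiteness of the state space gives one threshold for all x.\<close>
    then have "\<forall>\<^sub>F h in at_right 0. \<forall>x. x \<noteq> j \<longrightarrow>
        (c - \<eta>) * h \<le> v $ x - (P h *v v) $ x \<and> v $ x - (P h *v v) $ x \<le> (c + \<eta>) * h"
      by (rule eventually_all_finite)
    moreover have "filterlim (\<lambda>n. 1 / 2 ^ n :: real) (at_right 0) sequentially"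
    proof (rule tendsto_imp_filterlim_at_right)
      show "(\<lambda>n. 1 / 2 ^ n :: real) \<longlonglongrightarrow> 0" by (rule LIMSEQ_divide_realpow_zero) simp
    qed simp
    ultimately have "\<forall>\<^sub>F n in sequentially. \<forall>x. x \<noteq> j \<longrightarrow>
        (c - \<eta>) * (1 / 2 ^ n) \<le> v $ x - (P (1 / 2 ^ n) *v v) $ x \<and>
        v $ x - (P (1 / 2 ^ n) *v v) $ x \<le> (c + \<eta>) * (1 / 2 ^ n)"
      by (rule eventually_compose_filterlim)
    then show ?thesis
    proof eventually_elim
      case (elim n)
      define m where "m k = measure (started_at M X i)
        {\<omega> \<in> space M. \<forall>l\<le>k. X (real l * (1 / 2 ^ n)) \<omega> \<noteq> j}" for k
      have \<delta>: "0 < (1 / 2 ^ n :: real)" by simp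
      have lo: "0 < c - \<eta>" using \<eta> by simp
      have drift_n: "(c - \<eta>) * (1 / 2 ^ n) \<le> v $ x - (P (1 / 2 ^ n) *v v) $ x"
        "v $ x - (P (1 / 2 ^ n) *v v) $ x \<le> (c + \<eta>) * (1 / 2 ^ n)" if "x \<noteq> j" for x
        using elim that by blast+
      have b: "summable m"
        unfolding m_def[abs_def] by (rule skeleton_bounds(1)[OF \<delta> v lo drift_n])
      have b_lo: "(c - \<eta>) * (1 / 2 ^ n * suminf m) \<le> v $ i"
        unfolding m_def[abs_def] by (rule skeleton_bounds(2)[OF \<delta> v lo drift_n])
      have b_hi: "v $ i \<le> (c + \<eta>) * (1 / 2 ^ n * suminf m)"
        unfolding m_def[abs_def] by (rule skeleton_bounds(3)[OF \<delta> v lo drift_n])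
      have "T n = ennreal (1 / 2 ^ n * suminf m)"
        unfolding T_def m_def[abs_def]
        by (rule nn_integral_skeleton_time[OF \<delta> b[unfolded m_def[abs_def]]])
      moreover have "0 \<le> 1 / 2 ^ n * suminf m"
        by (intro mult_nonneg_nonneg suminf_nonneg b) (simp_all add: m_def)
      ultimately show ?case
        using b_lo b_hi by (intro exI[of _ "1 / 2 ^ n * suminf m"] conjI)
    qed
  qed
  \<comment> \<open>Decreasing monotone convergence fails without one finite integral. The choice
    \<eta> = c/2 provides it.\<close>
  have T_fin: "\<exists>n. T n < \<infinity>"
  proof -
    have "\<exists>n. \<exists>t\<ge>0. T n = ennreal t \<and> (c - c/2) * t \<le> v $ i \<and> v $ i \<le> (c + c/2) * t"
      by (rule eventually_happens'[OF sequentially_bot T]) (use c in simp_all)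
    then obtain n t where "T n = ennreal t" by blast
    then have "T n < \<infinity>" by simp
    then show ?thesis ..
  qed
  have dec: "decseq T"
  proof (rule decseq_SucI)
    show "T (Suc n) \<le> T n" for n
      unfolding T_def by (intro nn_integral_mono decseqD[OF decseq_skeleton_time] le_SucI order_refl)
  qed
  have "H = (\<integral>\<^sup>+\<omega>. (INF n. skeleton_time X j (1 / 2 ^ n) \<omega>) \<partial>(started_at M X i))"
    unfolding H_def by (rule nn_integral_cong) (simp add: hitting_time_eq_INF)
  also have "\<dots> = (INF n. T n)"
  proof -
    obtain n where n: "T n < \<infinity>" using T_fin ..
    have n': "(\<integral>\<^sup>+\<omega>. skeleton_time X j (1 / 2 ^ n) \<omega> \<partial>(started_at M X i)) < \<infinity>"
      using n unfolding T_def .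
    show ?thesis
      unfolding T_def
    proof (rule nn_integral_monotone_convergence_INF_decseq)
      show "decseq (\<lambda>n. skeleton_time X j (1 / 2 ^ n))"
        by (intro decseq_SucI le_funI decseq_SucD[OF decseq_skeleton_time])
      show "skeleton_time X j (1 / 2 ^ m) \<in> borel_measurable (started_at M X i)" for m
        unfolding measurable_cong_sets[OF sets_started_at refl] by (rule measurable_skeleton_time) simp
    qed (rule n')
  qed
  finally have H: "H = (INF n. T n)" .
  obtain n\<^sub>0 where n0: "T n\<^sub>0 < \<infinity>" using T_fin ..
  have "H \<le> T n\<^sub>0" unfolding H by (rule INF_lower) simp
  also note n0
  finally have "H < \<infinity>" .
  then obtain h where h: "0 \<le> h" "H = ennreal h" by (cases H rule: ennreal_cases) auto
  have bounds: "(c - \<eta>) * h \<le> v $ i" "v $ i \<le> (c + \<eta>) * h" if \<eta>: "0 < \<eta>" "\<eta> < c" for \<eta>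
  proof -
    from T[OF \<eta>, unfolded eventually_sequentially] obtain N where N: "\<forall>n\<ge>N. \<exists>t\<ge>0. T n = ennreal t \<and>
        (c - \<eta>) * t \<le> v $ i \<and> v $ i \<le> (c + \<eta>) * t" ..
    obtain t where t: "0 \<le> t" "T N = ennreal t" "(c - \<eta>) * t \<le> v $ i"
      using N[rule_format, OF order_refl] by (elim exE conjE) (rule that)
    have "H \<le> T N" unfolding H by (rule INF_lower) simp
    then have "h \<le> t" unfolding h(2) t(2) by (simp only: ennreal_le_iff[OF t(1)])
    then have "(c - \<eta>) * h \<le> (c - \<eta>) * t" using \<eta>(2) by (intro mult_left_mono) simp_all
    with t(3) show "(c - \<eta>) * h \<le> v $ i" by simp
    have c\<eta>: "0 < c + \<eta>" using \<eta> c by simp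
    have "ennreal (v $ i / (c + \<eta>)) \<le> H"
      unfolding H
    \<comment> \<open>The estimate is known only from level N on; since \<open>T\<close> decreases,
      the value at \<open>max n N\<close> bounds \<open>T n\<close> from below for every n.\<close>
    proof (rule INF_greatest)
      fix n
      obtain s where s: "0 \<le> s" "T (max n N) = ennreal s" "v $ i \<le> (c + \<eta>) * s"
        using N[rule_format, OF max.cobounded2[of N n]] by (elim exE conjE) (rule that)
      have "ennreal (v $ i / (c + \<eta>)) \<le> ennreal s"
        using s(3) by (intro ennreal_leI) (simp only: pos_divide_le_eq[OF c\<eta>] mult.commute)
      also have "\<dots> \<le> T n" unfolding s(2)[symmetric] by (rule decseqD[OF dec]) simp
      finally show "ennreal (v $ i / (c + \<eta>)) \<le> T n" .
    qed
    then have "v $ i / (c + \<eta>) \<le> h" unfolding h(2) by (simp only: ennreal_le_iff[OF h(1)])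
    then show "v $ i \<le> (c + \<eta>) * h" by (simp only: pos_divide_le_eq[OF c\<eta>] mult.commute)
  qed
  have eq: "v $ i = c * h"
  proof (rule antisym)
    have small: "\<exists>\<eta>>0. \<eta> < c \<and> \<eta> * h \<le> e" if e: "0 < e" for e
    proof (intro exI conjI)
      \<comment> \<open>The first argument keeps \<eta> below c; the denominator h + 1 avoids
        division by zero when h = 0.\<close>
      show "0 < min (c / 2) (e / (h + 1))" "min (c / 2) (e / (h + 1)) < c" using c e h by auto
      have "min (c / 2) (e / (h + 1)) * h \<le> e / (h + 1) * (h + 1)"
        using e h by (intro mult_mono) auto
      then show "min (c / 2) (e / (h + 1)) * h \<le> e" using h by simp
    qed
    show "v $ i \<le> c * h"
    proof (rule field_le_epsilon)
      fix e :: real assume "0 < e"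
      then obtain \<eta> where "0 < \<eta>" "\<eta> < c" "\<eta> * h \<le> e" using small by blast
      then show "v $ i \<le> c * h + e" using bounds(2)[of \<eta>] by (simp add: distrib_right)
    qed
    show "c * h \<le> v $ i"
    proof (rule field_le_epsilon)
      fix e :: real assume "0 < e"
      then obtain \<eta> where "0 < \<eta>" "\<eta> < c" "\<eta> * h \<le> e" using small by blast
      then show "c * h \<le> v $ i + e" using bounds(1)[of \<eta>] by (simp add: left_diff_distrib)
    qed
  qed
  then show "(\<integral>\<^sup>+\<omega>. hitting_time X j \<omega> \<partial>(started_at M X i)) = ennreal (v $ i / c)"
    using h(2) c unfolding H_def by simp
  show "0 \<le> v $ i" unfolding eq using c h(1) by simp
qed

end

text \<open>Mean hitting times are nonnegative extended integrals, since a Bochner integral would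
  silently be 0 in the non-integrable case. Equality with a real \<open>L\<close> thus asserts
  finiteness too, and the quantifier over i inside the scope of \<open>L\<close> expresses
  independence of the start.\<close>

theorem mainTheorem5:
  fixes M :: "'w measure"
    and X :: "real \<Rightarrow> 'w \<Rightarrow> 's::finite"
    and Q :: "real^'s^'s"
    and \<pi> :: "real^'s"
  assumes "continuous_time_markov_chain M X Q"
    and "irreducible_generator Q"
    and "stationary_distribution Q \<pi>"
    and "\<And>i. 0 < \<P>(\<omega> in M. X 0 \<omega> = i)"
  shows "\<exists>L::real.
    ((\<lambda>t. (\<Sum>j\<in>UNIV. \<integral>\<omega>. occupation_time X j t \<omega> \<partial>(started_at M X j)) - t) \<longlongrightarrow> L) at_top \<and>
    (\<forall>i. enn2ereal (\<Sum>j\<in>UNIV. ennreal (\<pi> $ j) * (\<integral>\<^sup>+\<omega>. hitting_time X j \<omega> \<partial>(started_at M X i)))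
           = ereal L)"
proof -
  obtain P where P: "transition_semigroup P Q" and
    mk: "\<And>n (\<tau> :: nat \<Rightarrow> real) (x :: nat \<Rightarrow> 's). 0 \<le> \<tau> 0 \<Longrightarrow> \<forall>k\<le>n. \<tau> k < \<tau> (Suc k) \<Longrightarrow>
           0 < \<P>(\<omega> in M. \<forall>k\<le>n. X (\<tau> k) \<omega> = x k) \<Longrightarrow>
           \<P>(\<omega> in M. X (\<tau> (Suc n)) \<omega> = x (Suc n) \<bar> \<forall>k\<le>n. X (\<tau> k) \<omega> = x k)
             = P (\<tau> (Suc n) - \<tau> n) $ x n $ x (Suc n)"
    using assms(1) unfolding continuous_time_markov_chain_def by blast
  have "prob_space M"
    using assms(1) unfolding continuous_time_markov_chain_def by blast
  then interpret prob_space M .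
  interpret markov_chain M P Q X
  proof
    show "transition_semigroup P Q" by (rule P)
    show "0 < \<P>(\<omega> in M. X 0 \<omega> = i)" for i by (rule assms(4))
    show "X t \<in> measurable M (count_space UNIV)" if "0 \<le> t" for t
      using assms(1) that unfolding continuous_time_markov_chain_def by blast
    show "\<forall>\<^sub>F u in at_right t. X u \<omega> = X t \<omega>" if "\<omega> \<in> space M" "0 \<le> t" for \<omega> t
      using assms(1) that unfolding continuous_time_markov_chain_def by blast
    show "\<P>(\<omega> in M. X (\<tau> (Suc n)) \<omega> = x (Suc n) \<bar> \<forall>k\<le>n. X (\<tau> k) \<omega> = x k)
        = P (\<tau> (Suc n) - \<tau> n) $ x n $ x (Suc n)"
      if "0 \<le> \<tau> 0" "\<And>k. k \<le> n \<Longrightarrow> \<tau> k < \<tau> (Suc k)"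
        "0 < \<P>(\<omega> in M. \<forall>k\<le>n. X (\<tau> k) \<omega> = x k)" for \<tau> n x
      by (rule mk[OF that(1) _ that(3)]) (intro allI impI that(2))
  qed
  obtain Z :: "real^'s^'s" where
    QZ: "\<And>i j. (Q ** Z) $ i $ j = \<pi> $ j - mat 1 $ i $ j" and
    Z1: "\<And>i. (\<Sum>j\<in>UNIV. Z $ i $ j) = 1" and
    \<pi>Z: "\<And>j. (\<Sum>i\<in>UNIV. \<pi> $ i * Z $ i $ j) = \<pi> $ j"
    by (rule fundamental_matrix[OF assms(2,3)]) (rule that)
  have \<pi>1: "(\<Sum>j\<in>UNIV. \<pi> $ j) = 1" using assms(3) by (simp add: stationary_distribution_def)
  have Q1: "(\<Sum>j\<in>UNIV. Q $ i $ j) = 0" for i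
    using assms(2) by (simp add: irreducible_generator_def generator_matrix_def)
  define L where "L = (\<Sum>j\<in>UNIV. Z $ j $ j) - 1"
  have "((\<lambda>t. (\<Sum>j\<in>UNIV. \<integral>\<omega>. occupation_time X j t \<omega> \<partial>(started_at M X j)) - t) \<longlongrightarrow> L) at_top"
  proof -
    \<comment> \<open>Each diagonal entry of P(t) Z tends to (\<pi> Z)_j = \<pi>_j. These limits add
      up to 1, the constant subtracted in \<open>L\<close>.\<close>
    have "((\<lambda>t. \<Sum>k\<in>UNIV. P t $ j $ k * Z $ k $ j) \<longlongrightarrow> (\<Sum>k\<in>UNIV. \<pi> $ k * Z $ k $ j)) at_top" for j
      by (intro tendsto_sum tendsto_mult tendsto_const convergence assms(2,3))
    then have "((\<lambda>t. (P t ** Z) $ j $ j) \<longlongrightarrow> \<pi> $ j) at_top" for j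
      by (simp add: matrix_matrix_mult_def \<pi>Z)
    then have "((\<lambda>t. (\<Sum>j\<in>UNIV. Z $ j $ j) - (\<Sum>j\<in>UNIV. (P t ** Z) $ j $ j)) \<longlongrightarrow>
        (\<Sum>j\<in>UNIV. Z $ j $ j) - (\<Sum>j\<in>UNIV. \<pi> $ j)) at_top"
      by (intro tendsto_diff tendsto_const tendsto_sum)
    moreover have "\<forall>\<^sub>F t in at_top. (\<Sum>j\<in>UNIV. Z $ j $ j) - (\<Sum>j\<in>UNIV. (P t ** Z) $ j $ j)
      = (\<Sum>j\<in>UNIV. \<integral>\<omega>. occupation_time X j t \<omega> \<partial>(started_at M X j)) - t"
    proof (rule eventually_mono[OF eventually_ge_at_top[of 0]])
      fix t :: real assume t: "0 \<le> t"
      have "(\<Sum>j\<in>UNIV. \<integral>\<omega>. occupation_time X j t \<omega> \<partial>(started_at M X j))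
        = (\<Sum>j\<in>UNIV. t * \<pi> $ j + Z $ j $ j - (P t ** Z) $ j $ j)"
        by (intro sum.cong refl) (simp only: expectation_occupation_time[OF t] integral_diagonal[OF QZ t])
      also have "\<dots> = t + (\<Sum>j\<in>UNIV. Z $ j $ j) - (\<Sum>j\<in>UNIV. (P t ** Z) $ j $ j)"
        by (simp only: sum_subtractf sum.distrib sum_distrib_left[symmetric] \<pi>1 mult_1_right)
      finally show "(\<Sum>j\<in>UNIV. Z $ j $ j) - (\<Sum>j\<in>UNIV. (P t ** Z) $ j $ j)
        = (\<Sum>j\<in>UNIV. \<integral>\<omega>. occupation_time X j t \<omega> \<partial>(started_at M X j)) - t" by simp
    qed
    ultimately show ?thesis
      unfolding L_def \<pi>1 by (rule Lim_transform_eventually)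
  qed
  moreover have "enn2ereal (\<Sum>j\<in>UNIV. ennreal (\<pi> $ j) * (\<integral>\<^sup>+\<omega>. hitting_time X j \<omega> \<partial>(started_at M X i)))
      = ereal L" for i
  proof -
    have hit: "ennreal (\<pi> $ j) * (\<integral>\<^sup>+\<omega>. hitting_time X j \<omega> \<partial>(started_at M X i))
        = ennreal (Z $ j $ j - Z $ i $ j)" and nonneg: "0 \<le> Z $ j $ j - Z $ i $ j" for j
    proof -
      define v :: "real^'s" where "v = (\<chi> x. Z $ j $ j - Z $ x $ j)"
      have \<pi>j: "0 < \<pi> $ j" by (rule stationary_distribution_pos[OF assms(2,3)])
      have v: "v $ j = 0" by (simp add: v_def)
      have drift: "(Q *v v) $ x = - (\<pi> $ j)" if "x \<noteq> j" for x
      proof -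
        \<comment> \<open>The constant Z_jj is annihilated by the zero row sums of Q; away from j
          the identity matrix in Q Z contributes nothing.\<close>
        have "(Q *v v) $ x = (\<Sum>k\<in>UNIV. Q $ x $ k) * Z $ j $ j - (Q ** Z) $ x $ j"
          by (simp add: v_def matrix_vector_mult_def matrix_matrix_mult_def right_diff_distrib
              sum_subtractf sum_distrib_right)
        then show ?thesis using that by (simp add: Q1 QZ mat_def)
      qed
      note * = nn_integral_hitting_time[OF v \<pi>j drift, of i]
      show "0 \<le> Z $ j $ j - Z $ i $ j" using *(2) by (simp add: v_def)
      have "ennreal (\<pi> $ j) * ennreal (v $ i / \<pi> $ j) = ennreal (v $ i)"
        using \<pi>j *(2) by (simp flip: ennreal_mult)
      then show "ennreal (\<pi> $ j) * (\<integral>\<^sup>+\<omega>. hitting_time X j \<omega> \<partial>(started_at M X i))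
          = ennreal (Z $ j $ j - Z $ i $ j)"
        by (simp add: *(1)) (simp add: v_def)
    qed
    have "(\<Sum>j\<in>UNIV. ennreal (\<pi> $ j) * (\<integral>\<^sup>+\<omega>. hitting_time X j \<omega> \<partial>(started_at M X i)))
      = ennreal (\<Sum>j\<in>UNIV. Z $ j $ j - Z $ i $ j)"
      unfolding hit by (rule sum_ennreal) (rule nonneg)
    \<comment> \<open>The start i enters only through a row sum of Z, which is always 1.\<close>
    also have "(\<Sum>j\<in>UNIV. Z $ j $ j - Z $ i $ j) = L"
      by (simp add: sum_subtractf Z1 L_def)
    moreover have "0 \<le> L"
      unfolding calculation(2)[symmetric] by (rule sum_nonneg) (rule nonneg)
    ultimately show ?thesis by (simp add: enn2ereal_ennreal)
  qed
  ultimately show ?thesis by blast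
qed

end
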